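(* Let $\alpha$ be a distribution on environments $\omega=\{\omega_x\}_{x\in\mathbb{Z}}\in[0,1]^{\mathbb{Z}}$ under which $\{\omega_x\}_{x\in\mathbb{Z}}$ is i.i.d., and write $\rho_x=(1-\omega_x)/\omega_x$. Assume that $E_\alpha[\log\rho_0]<0$, that $E_\alpha[\rho_0^s]=1$ for some $s>1$, that the distribution of $\log\rho_0$ under $\alpha$ is non-lattice, and that $E_\alpha[\rho_0^s\log\rho_0]<\infty$. Let $v_\alpha=\frac{1-E_\alpha[\rho_0]}{1+E_\alpha[\rho_0]}>0$. Then for any $v\in(0,v_\alpha)$, $$\liminf_{n\to\infty}\frac{1}{n^{1-1/s}}\log P_\omega\left(\frac{X_n}{n}<v\right)=-\infty,\qquad \text{for } \alpha\text{-a.e. } \omega.$$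
   Context: $E_\alpha$ denotes expectation with respect to $\alpha$. For a fixed environment $\omega$, $P_\omega$ (the quenched law) is the law of the nearest-neighbour Markov chain $(X_n)_{n\ge 0}$ on $\mathbb{Z}$ with $X_0=0$ and transition probabilities $P_\omega(X_{n+1}=x+1\mid X_n=x)=\omega_x$, $P_\omega(X_{n+1}=x-1\mid X_n=x)=1-\omega_x$. Under the stated assumptions $E_\alpha[\rho_0]<1$ and $v_\alpha$ is the almost sure limit of $X_n/n$. Convention: $\log 0=-\infty$. *)

theory Defs
  imports "HOL-Probability.Probability"
begin

section \<open>Extended real arithmetic\<close>

text \<open>On the interval from 0 to infinity these are the monotone continuous extensions of the
  logarithm and (for positive exponent) of the power function: the logarithm of 0 is minus
  infinity. Their values on negative arguments play no role.\<close>

definition log_ereal :: "ereal \<Rightarrow> ereal" where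
  "log_ereal x = (if x \<le> 0 then - \<infinity> else if x = \<infinity> then \<infinity> else ereal (ln (real_of_ereal x)))"

definition powr_ereal :: "ereal \<Rightarrow> real \<Rightarrow> ereal" where
  "powr_ereal x s = (if x = \<infinity> then \<infinity> else ereal (real_of_ereal x powr s))"

text \<open>The expectation of an extended real random variable is the difference of the expectations
  of its positive and negative parts. If both are infinite it does not exist; the value is then
  plus infinity, because this is how subtraction of extended reals is totalised, so a bound
  of the form \<open>ext_expectation M f < c\<close> entails that the expectation is well defined.\<close>

definition ext_expectation :: "'a measure \<Rightarrow> ('a \<Rightarrow> ereal) \<Rightarrow> ereal" where
  "ext_expectation M f =
     enn2ereal (\<integral>\<^sup>+ x. e2ennreal (f x) \<partial>M) - enn2ereal (\<integral>\<^sup>+ x. e2ennreal (- f x) \<partial>M)"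

text \<open>The distribution of \<open>Y\<close> is lattice if for some \<open>h > 0\<close> it is carried by the multiples of
  \<open>h\<close>, as in renewal theory (also called arithmetic). The value minus infinity, which
  the logarithm of a random variable may take, is disregarded: it is allowed in every lattice.\<close>

definition non_lattice :: "'a measure \<Rightarrow> ('a \<Rightarrow> ereal) \<Rightarrow> bool" where
  "non_lattice M Y \<longleftrightarrow>
     \<not> (\<exists>h>0. AE x in M. Y x = - \<infinity> \<or> (\<exists>k::int. Y x = ereal (h * real_of_int k)))"


section \<open>Random environments\<close>

type_synonym env = "int \<Rightarrow> real"

definition env_space :: "env measure" where
  "env_space = (\<Pi>\<^sub>M x\<in>UNIV. restrict_space borel {0..1})"

definition iid_environment :: "env measure \<Rightarrow> bool" where
  "iid_environment \<alpha> \<longleftrightarrow>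
     prob_space \<alpha> \<and> sets \<alpha> = sets env_space \<and>
     prob_space.indep_vars \<alpha> (\<lambda>_. borel) (\<lambda>x \<omega>. \<omega> x) UNIV \<and>
     (\<forall>x. distr \<alpha> borel (\<lambda>\<omega>. \<omega> x) = distr \<alpha> borel (\<lambda>\<omega>. \<omega> 0))"

text \<open>Extended real division makes \<open>rho \<omega> x\<close> infinite where \<open>\<omega> x = 0\<close>.\<close>

definition rho :: "env \<Rightarrow> int \<Rightarrow> ereal" where
  "rho \<omega> x = ereal (1 - \<omega> x) / ereal (\<omega> x)"

definition speed :: "env measure \<Rightarrow> ereal" where
  "speed \<alpha> = (1 - ext_expectation \<alpha> (\<lambda>\<omega>. rho \<omega> 0)) / (1 + ext_expectation \<alpha> (\<lambda>\<omega>. rho \<omega> 0))"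


section \<open>The quenched law\<close>

text \<open>Conditional distribution of \<open>X i\<close> given the path \<open>X\<close> before time \<open>i\<close>.\<close>

primrec walk_kernel :: "env \<Rightarrow> nat \<Rightarrow> (nat \<Rightarrow> int) \<Rightarrow> int pmf" where
  "walk_kernel \<omega> 0 X = return_pmf 0"
| "walk_kernel \<omega> (Suc n) X =
     map_pmf (\<lambda>b. if b then X n + 1 else X n - 1) (bernoulli_pmf (\<omega> (X n)))"

interpretation walk: Ionescu_Tulcea
  "\<lambda>i X. measure_pmf (walk_kernel \<omega> i X)" "\<lambda>_. count_space UNIV" for \<omega>
proof (rule Ionescu_Tulcea.intro)
  fix i
  show "(\<lambda>X. measure_pmf (walk_kernel \<omega> i X))
      \<in> Pi\<^sub>M {0..<i} (\<lambda>_. count_space UNIV) \<rightarrow>\<^sub>M subprob_algebra (count_space UNIV)"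
  proof (cases i)
    case 0
    then show ?thesis by (simp add: measure_pmf_in_subprob_algebra)
  next
    case (Suc n)
    let ?N = "subprob_algebra (count_space (UNIV :: int set))"
    let ?g = "\<lambda>y. measure_pmf (map_pmf (\<lambda>b. if b then y + 1 else y - 1) (bernoulli_pmf (\<omega> y)))"
    have "?g \<in> count_space UNIV \<rightarrow>\<^sub>M ?N"
      by (simp add: Pi_iff measure_pmf_in_subprob_algebra)
    moreover have "(\<lambda>X. X n) \<in> Pi\<^sub>M {0..<i} (\<lambda>_. count_space (UNIV :: int set)) \<rightarrow>\<^sub>M count_space UNIV"
      using Suc by (intro measurable_component_singleton) simp
    ultimately have "(\<lambda>X. ?g (X n)) \<in> Pi\<^sub>M {0..<i} (\<lambda>_. count_space UNIV) \<rightarrow>\<^sub>M ?N"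
      by (rule measurable_compose_rev)
    then show ?thesis by (simp add: Suc)
  qed
next
  show "prob_space (measure_pmf (walk_kernel \<omega> i X))" for i X
    by (rule measure_pmf.prob_space_axioms)
qed

definition quenched_law :: "env \<Rightarrow> (nat \<Rightarrow> int) measure" where
  "quenched_law \<omega> = projective_family.lim UNIV (walk.CI \<omega>) (\<lambda>_. count_space UNIV)"

lemma space_quenched_law [simp]: "space (quenched_law \<omega>) = UNIV"
  by (simp add: quenched_law_def space_PiM)

lemma sets_quenched_law: "sets (quenched_law \<omega>) = sets (Pi\<^sub>M UNIV (\<lambda>_. count_space UNIV))"
  by (simp add: quenched_law_def)

lemma prob_space_quenched_law: "prob_space (quenched_law \<omega>)"
proof
  let ?M = "\<lambda>_. count_space (UNIV :: int set)"
  have "emeasure (quenched_law \<omega>) (space (quenched_law \<omega>)) =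
      emeasure (quenched_law \<omega>) (prod_emb UNIV ?M {} (space (Pi\<^sub>M {} ?M)))"
    by (rule arg_cong[where f = "emeasure _"]) (auto simp: prod_emb_def space_PiM)
  also have "\<dots> = emeasure (walk.CI \<omega> {}) (space (Pi\<^sub>M {} ?M))"
    unfolding quenched_law_def by (rule walk.lim) auto
  also have "\<dots> = 1"
    using prob_space.emeasure_space_1[OF walk.PF.prob_space_P[of "{}" \<omega>]]
    by (simp add: walk.PF.space_P)
  finally show "emeasure (quenched_law \<omega>) (space (quenched_law \<omega>)) = 1" .
qed

lemma walk_kernel_cong:
  "(\<And>j. j < i \<Longrightarrow> X j = Y j) \<Longrightarrow> walk_kernel \<omega> i X = walk_kernel \<omega> i Y"
  by (cases i) (simp_all cong: if_cong)

lemma sets_singleton_PiM: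
  fixes x :: "nat \<Rightarrow> int"
  shows "{restrict x {0..<n}} \<in> sets (Pi\<^sub>M {0..<n} (\<lambda>_. count_space (UNIV :: int set)))"
proof -
  have "{restrict x {0..<n}} = (\<Pi>\<^sub>E i\<in>{0..<n}. {x i})"
    by (auto simp: PiE_iff extensional_def restrict_def fun_eq_iff)
  also have "\<dots> \<in> sets (Pi\<^sub>M {0..<n} (\<lambda>_. count_space (UNIV :: int set)))"
    by (rule sets_PiM_I_finite) simp_all
  finally show ?thesis .
qed

lemma emeasure_walk_C:
  "emeasure (walk.C \<omega> 0 n (\<lambda>_. undefined)) {restrict x {0..<n}} =
     (\<Prod>i<n. ennreal (pmf (walk_kernel \<omega> i x) (x i)))"
proof (induction n)
  case 0
  have "{restrict x {}} \<in> sets (Pi\<^sub>M {} (\<lambda>_. count_space (UNIV :: int set)))"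
    using sets_singleton_PiM[of x 0] by simp
  then show ?case by (simp add: restrict_def)
next
  case (Suc n)
  let ?M = "\<lambda>n. Pi\<^sub>M {0..<n} (\<lambda>_. count_space (UNIV :: int set))"
  let ?C = "walk.C \<omega> 0 n (\<lambda>_. undefined)"
  let ?p = "ennreal (pmf (walk_kernel \<omega> n x) (x n))"
  have undef: "(\<lambda>_. undefined) \<in> space (?M 0)"
    by (simp add: space_PiM PiE_iff extensional_def)
  have sets_C: "sets ?C = sets (?M n)"
    using walk.sets_C[OF undef, of \<omega> n] by simp
  have space_C: "space ?C = space (?M n)"
    using sets_C by (rule sets_eq_imp_space_eq)
  have eP: "walk.eP \<omega> n y {restrict x {0..<Suc n}} = ?p * indicator {restrict x {0..<n}} y"
    if y: "y \<in> space (?M n)" for y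
  proof -
    have "walk.eP \<omega> n y {restrict x {0..<Suc n}} =
        measure_pmf (walk_kernel \<omega> n y) ((\<lambda>z. y(n := z)) -` {restrict x {0..<Suc n}})"
      using walk.emeasure_eP[OF y sets_singleton_PiM] by simp
    also have "\<dots> = ?p * indicator {restrict x {0..<n}} y"
    proof (cases "y = restrict x {0..<n}")
      case True
      have "y(n := z) = restrict x {0..<Suc n} \<longleftrightarrow> z = x n" for z
        unfolding True by (auto simp: fun_eq_iff restrict_def less_Suc_eq)
      then have "(\<lambda>z. y(n := z)) -` {restrict x {0..<Suc n}} = {x n}"
        by auto
      moreover have "walk_kernel \<omega> n y = walk_kernel \<omega> n x"
        using True by (intro walk_kernel_cong) simp
      ultimately show ?thesis
        using True by (simp add: emeasure_pmf_single)
    next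
      case False
      have "(\<lambda>z. y(n := z)) -` {restrict x {0..<Suc n}} = {}"
      proof (rule equals0I)
        fix z assume "z \<in> (\<lambda>z. y(n := z)) -` {restrict x {0..<Suc n}}"
        then have *: "y(n := z) = restrict x {0..<Suc n}" by simp
        have "y i = restrict x {0..<n} i" for i
          using fun_cong[OF *, of i] y
          by (cases "i < n"; cases "i = n") (auto simp: space_PiM PiE_iff extensional_def)
        with False show False by (auto simp: fun_eq_iff)
      qed
      with False show ?thesis by simp
    qed
    finally show ?thesis .
  qed
  have "emeasure (walk.C \<omega> 0 (Suc n) (\<lambda>_. undefined)) {restrict x {0..<Suc n}} =
      (\<integral>\<^sup>+ y. walk.eP \<omega> n y {restrict x {0..<Suc n}} \<partial>?C)"
    unfolding walk.C.simps add_0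
  proof (rule emeasure_bind)
    show "space ?C \<noteq> {}"
      using space_C by (simp add: space_PiM PiE_eq_empty_iff)
    show "walk.eP \<omega> n \<in> ?C \<rightarrow>\<^sub>M subprob_algebra (?M (Suc n))"
      unfolding measurable_cong_sets[OF sets_C refl] by (rule walk.measurable_eP)
  qed (rule sets_singleton_PiM)
  also have "\<dots> = (\<integral>\<^sup>+ y. ?p * indicator {restrict x {0..<n}} y \<partial>?C)"
    by (intro nn_integral_cong) (simp add: eP space_C)
  also have "\<dots> = ?p * emeasure ?C {restrict x {0..<n}}"
    by (rule nn_integral_cmult_indicator) (simp only: sets_C sets_singleton_PiM)
  finally show ?case
    by (simp only: Suc.IH prod.lessThan_Suc mult.commute)
qed

text \<open>The finite-dimensional distributions, which determine \<open>quenched_law \<omega>\<close>.\<close>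

theorem quenched_law_cylinder:
  "measure (quenched_law \<omega>) {X. \<forall>i<n. X i = x i} = (\<Prod>i<n. pmf (walk_kernel \<omega> i x) (x i))"
proof -
  let ?M = "\<lambda>_. count_space (UNIV :: int set)"
  have "restrict X {0..<n} = restrict x {0..<n} \<longleftrightarrow> (\<forall>i<n. X i = x i)" for X :: "nat \<Rightarrow> int"
    by (metis atLeastLessThan_iff le0 restrict_apply' restrict_ext)
  then have "{X. \<forall>i<n. X i = x i} = prod_emb UNIV ?M {0..<n} {restrict x {0..<n}}"
    by (auto simp: prod_emb_def space_PiM)
  then have "emeasure (quenched_law \<omega>) {X. \<forall>i<n. X i = x i} =
      emeasure (walk.CI \<omega> {0..<n}) {restrict x {0..<n}}"
    unfolding quenched_law_def by (simp add: walk.lim sets_singleton_PiM)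
  also have "\<dots> = emeasure (walk.C \<omega> 0 n (\<lambda>_. undefined)) {restrict x {0..<n}}"
    using sets_singleton_PiM[of x n, THEN sets.sets_into_space]
    by (subst walk.emeasure_CI[of _ n]) (simp_all add: sets_singleton_PiM prod_emb_id space_PiM)
  also have "\<dots> = ennreal (\<Prod>i<n. pmf (walk_kernel \<omega> i x) (x i))"
    by (simp add: emeasure_walk_C prod_ennreal)
  finally show ?thesis
    by (simp add: measure_def prod_nonneg)
qed

corollary quenched_law_start: "measure (quenched_law \<omega>) {X. X 0 = 0} = 1"
  using quenched_law_cylinder[of \<omega> 1 "\<lambda>_. 0"] by simp

corollary quenched_law_step:
  assumes "\<omega> (x n) \<in> {0..1}"
  shows "x (Suc n) = x n + 1 \<Longrightarrow> measure (quenched_law \<omega>) {X. \<forall>i<Suc (Suc n). X i = x i} =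
           measure (quenched_law \<omega>) {X. \<forall>i<Suc n. X i = x i} * \<omega> (x n)"
    and "x (Suc n) = x n - 1 \<Longrightarrow> measure (quenched_law \<omega>) {X. \<forall>i<Suc (Suc n). X i = x i} =
           measure (quenched_law \<omega>) {X. \<forall>i<Suc n. X i = x i} * (1 - \<omega> (x n))"
proof -
  let ?f = "\<lambda>b. if b then x n + 1 else x n - 1"
  have "inj ?f"
    by (auto simp: inj_def split: if_splits)
  note pmf_map = pmf_map_inj'[OF this, of "bernoulli_pmf (\<omega> (x n))"]
  have *: "pmf (walk_kernel \<omega> (Suc n) x) (x n + 1) = \<omega> (x n)"
    "pmf (walk_kernel \<omega> (Suc n) x) (x n - 1) = 1 - \<omega> (x n)"
    using pmf_map[of True] pmf_map[of False] assms by simp_all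
  show "x (Suc n) = x n + 1 \<Longrightarrow> measure (quenched_law \<omega>) {X. \<forall>i<Suc (Suc n). X i = x i} =
           measure (quenched_law \<omega>) {X. \<forall>i<Suc n. X i = x i} * \<omega> (x n)"
    and "x (Suc n) = x n - 1 \<Longrightarrow> measure (quenched_law \<omega>) {X. \<forall>i<Suc (Suc n). X i = x i} =
           measure (quenched_law \<omega>) {X. \<forall>i<Suc n. X i = x i} * (1 - \<omega> (x n))"
    unfolding quenched_law_cylinder prod.lessThan_Suc[of _ "Suc n"]
    by (simp_all only: *)
qed

end

theory Submission
  imports Defs
begin

text \<open>For small \<open>l > 0\<close> one looks for numbers \<open>\<phi> x = 1 + u x \<ge> 1\<close> such that the function
  \<open>h\<close> with \<open>h x = \<phi> x * h (x + 1)\<close> satisfies \<open>P h = (1 - l) * h\<close> for the quenched transition operator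
  \<open>P\<close> on \<open>(-n, n)\<close>. Then \<open>P\<^sub>\<omega>(X n < N)\<close> is at most \<open>(1 - l) ^ n\<close> times the product of \<open>\<phi> x\<close> over
  \<open>0 \<le> x < N\<close>. The numbers \<open>u x\<close> are given by a recursion in \<open>x\<close> driven by the i.i.d. ratios
  \<open>\<rho> x\<close>, hence by a Markov chain under \<open>\<alpha>\<close>, started at \<open>u (-n) = 0\<close>.

  Take \<open>l = L / n powr (1/s)\<close>. A Lyapunov function of order \<open>u powr s\<close> shows that the
  chain stays below a fixed level for \<open>2 * n\<close> steps with probability at least
  \<open>(1 - C * l powr s) ^ (2 * n)\<close>, which is bounded below: with positive probability there are no deep
  traps. A second Lyapunov function shows that then, with probability tending to 1, the product of
  \<open>\<phi> x\<close> over \<open>0 \<le> x < n * v\<close> is at most \<open>exp (l * n * (1 - \<delta>))\<close> for some \<open>\<delta> > 0\<close>, because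
  \<open>v\<close> is less than the speed. So \<open>P\<^sub>\<omega>(X n < n * v) \<le> exp (- \<delta> * L * n powr (1 - 1/s))\<close> with
  probability bounded below, also conditionally on any finite part of the environment; hence almost
  surely for infinitely many \<open>n\<close>, for every \<open>L\<close>.\<close>

section \<open>Inequalities for powers\<close>

lemma powr_strict_Bernoulli:
  fixes y d :: real
  assumes "0 \<le> y" "y \<noteq> 1" "1 < d"
  shows "1 + d * (y - 1) < y powr d"
proof (cases "y = 0")
  case True
  then show ?thesis using assms by simp
next
  case False
  with assms have y: "0 < y" by simp
  have der: "((\<lambda>y. y powr d) has_real_derivative d * x powr (d - 1)) (at x)" if "0 < x" for x
    using that by (rule has_real_derivative_powr)
  show ?thesis
  proof (cases "1 < y")
    case True
    then obtain z where z: "1 < z" "z < y" "y powr d - 1 powr d = (y - 1) * (d * z powr (d - 1))"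
      using MVT2[of 1 y "\<lambda>y. y powr d" "\<lambda>x. d * x powr (d - 1)"] der by force
    have "1 < z powr (d - 1)"
      using z assms by (intro gr_one_powr) auto
    then have "(y - 1) * (d * 1) < (y - 1) * (d * z powr (d - 1))"
      using True assms by (intro mult_strict_left_mono) auto
    with z show ?thesis by (simp add: algebra_simps)
  next
    case False
    with assms have y1: "y < 1" by simp
    then obtain z where z: "y < z" "z < 1" "1 powr d - y powr d = (1 - y) * (d * z powr (d - 1))"
      using MVT2[of y 1 "\<lambda>y. y powr d" "\<lambda>x. d * x powr (d - 1)"] der y by force
    have "z powr (d - 1) < 1 powr (d - 1)"
      using z y assms by (intro powr_less_mono2) auto
    then have "(1 - y) * (d * z powr (d - 1)) < (1 - y) * (d * 1)"
      using y1 assms by (intro mult_strict_left_mono) auto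
    with z show ?thesis by (simp add: algebra_simps)
  qed
qed

text \<open>In \<open>y = t powr s\<close> the power \<open>y powr (b / s)\<close> is strictly
  concave, so it lies below its tangent at 1. When \<open>t powr s\<close> has mean 1, the right
  side averages to 1.\<close>

lemma powr_less_affine:
  fixes t b s :: real
  assumes "0 \<le> t" "t \<noteq> 1" "0 < b" "b < s"
  shows "t powr b < 1 + b / s * (t powr s - 1)"
proof -
  have "t powr b \<noteq> 1"
    using assms by (cases "t = 0") (auto simp: powr_def)
  then have "1 + s / b * (t powr b - 1) < (t powr b) powr (s / b)"
    using assms by (intro powr_strict_Bernoulli) auto
  also have "(t powr b) powr (s / b) = t powr s"
    using assms by (simp add: powr_powr)
  finally show ?thesis using assms by (simp add: field_simps)
qed

text \<open>The left side averages to 0 when \<open>t powr s\<close> has mean 1, so the mean of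
  \<open>t powr s * min t 3\<close> exceeds 1. The cap keeps that mean finite without a moment of
  order \<open>s + 1\<close>; the value 3 fits the Lyapunov scale \<open>6 * k\<close> on the range
  \<open>u \<le> 2 * k\<close>.\<close>

lemma powr_mult_min_gt:
  fixes t s :: real
  assumes t: "0 \<le> t" "t \<noteq> 1" and s: "1 < s"
  shows "(t powr s - 1) / s < t powr s * (min t 3 - 1)"
proof -
  consider "t = 0" | "0 < t" "t \<le> 3" | "3 < t" using t by linarith
  then show ?thesis
  proof cases
    case 1
    then show ?thesis using s by simp
  next
    case 2
    \<comment> \<open>Below the cap the claim is Bernoulli's inequality for \<open>1 / t\<close>
      with exponent \<open>s + 1\<close>, multiplied by \<open>t powr (s + 1)\<close>.\<close>
    have "1 + (s + 1) * (1 / t - 1) < (1 / t) powr (s + 1)"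
      using 2 t s by (intro powr_strict_Bernoulli) auto
    also have "(1 / t) powr (s + 1) = 1 / t powr (s + 1)"
      using 2 by (simp add: powr_divide)
    finally have "(1 + (s + 1) * (1 / t - 1)) * t powr (s + 1) < 1"
      using 2 by (simp add: field_simps)
    moreover have "t powr (s + 1) = t powr s * t"
      using 2 by (simp add: powr_add)
    ultimately have "(1 + (s + 1) * (1 / t - 1)) * (t powr s * t) < 1" by simp
    moreover have "(1 + (s + 1) * (1 / t - 1)) * (t powr s * t) = t powr s * ((s + 1) - s * t)"
      using 2 by (simp add: field_simps)
    ultimately have "t powr s * ((s + 1) - s * t) < 1" by simp
    then show ?thesis using 2 s by (simp add: field_simps)
  next
    case 3
    have "t powr s - 1 < t powr s * s"
      using s mult_left_mono[of 1 s "t powr s"] by simp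
    moreover have "t powr s * 2 = t powr s * (min t 3 - 1)" using 3 by simp
    moreover have "(t powr s - 1) / s < t powr s"
      using s calculation by (simp add: divide_less_eq)
    moreover have "0 \<le> t powr s" by simp
    ultimately show ?thesis by linarith
  qed
qed

text \<open>Comparing \<open>B\<close> with \<open>e * A\<close> leaves only one of the two terms.
  For small \<open>e\<close> the factor of \<open>A\<close> is close to 1, which preserves a
  contraction at the price of a large factor on the source \<open>B\<close>.\<close>

lemma powr_add_le_weighted:
  fixes A B b e :: real
  assumes "0 \<le> A" "0 \<le> B" "0 < b" "0 < e"
  shows "(A + B) powr b \<le> (1 + e) powr b * A powr b + (1 + 1 / e) powr b * B powr b"
proof (cases "B \<le> e * A")
  case True
  then have "(A + B) powr b \<le> ((1 + e) * A) powr b"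
    using assms by (intro powr_mono2) (auto simp: algebra_simps)
  then show ?thesis using assms by (simp add: powr_mult add_increasing2)
next
  case False
  then have "(A + B) powr b \<le> ((1 + 1 / e) * B) powr b"
    using assms by (intro powr_mono2) (auto simp: field_simps)
  then show ?thesis using assms by (simp add: powr_mult add_increasing)
qed

text \<open>At the critical exponent \<open>A powr s\<close> must keep the exact coefficient 1, so
  the mean value theorem replaces the weighted bound. As \<open>l \<le> A + l\<close>, half a power
  of \<open>l\<close> is traded for half a power of \<open>A + l\<close>, and the error gets the
  subcritical exponent \<open>s - 1/2\<close>.\<close>

lemma powr_add_le_tangent:
  fixes A l s :: real
  assumes "0 \<le> A" "0 < l" "1 < s"
  shows "(A + l) powr s \<le> A powr s + s * l powr (1/2) * (A + l) powr (s - 1/2)"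
proof -
  have cont: "continuous_on {A..A + l} (\<lambda>x. x powr s)"
    using assms by (intro continuous_on_powr') (auto intro!: continuous_intros)
  have "\<exists>D z. A < z \<and> z < A + l \<and> ((\<lambda>x. x powr s) has_real_derivative D) (at z) \<and>
      (A + l) powr s - A powr s = (A + l - A) * D"
    using assms cont by (intro MVT) (auto intro!: exI has_real_derivative_powr simp: real_differentiable_def)
  then obtain D z where z: "A < z" "z < A + l" "((\<lambda>x. x powr s) has_real_derivative D) (at z)"
      "(A + l) powr s - A powr s = l * D"
    by auto
  have D: "D = s * z powr (s - 1)"
    using z assms by (intro DERIV_unique[OF z(3)] has_real_derivative_powr) auto
  have "l * z powr (s - 1) \<le> l * (A + l) powr (s - 1)"
    using z assms by (intro mult_left_mono powr_mono2) auto
  also have "\<dots> = l powr (1/2) * (l powr (1/2) * (A + l) powr (s - 1))"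
    using assms by (simp add: powr_half_sqrt)
  also have "\<dots> \<le> l powr (1/2) * ((A + l) powr (1/2) * (A + l) powr (s - 1))"
    using assms by (intro mult_left_mono mult_right_mono powr_mono2) auto
  also have "(A + l) powr (1/2) * (A + l) powr (s - 1) = (A + l) powr (s - 1/2)"
    by (simp flip: powr_add)
  finally show ?thesis using z D assms by (simp add: algebra_simps)
qed

text \<open>The factor \<open>1 / (1 - q)\<close> is at most \<open>1 + 2 * q\<close>, the convex
  combination of 1 and 2 with weight \<open>2 * q\<close> on 2; convexity of the power puts its
  value below the chord.\<close>

lemma one_minus_powr_le:
  fixes q s :: real
  assumes "0 \<le> q" "q \<le> 1/2" "1 < s"
  shows "(1 / (1 - q)) powr s \<le> 1 + 2 powr (s + 1) * q"
proof -
  have "convex_on {0<..} (\<lambda>x::real. x powr s)"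
    using assms by (intro powr_convex) auto
  from convex_onD[OF this, of "2 * q" 1 2]
  have *: "((1 - 2 * q) * 1 + 2 * q * 2) powr s \<le> (1 - 2 * q) * 1 powr s + 2 * q * 2 powr s"
    using assms by simp
  have "1 / (1 - q) \<le> 1 + 2 * q"
    using assms by (simp add: field_simps) (use mult_left_mono[of q "1/2" q] assms in auto)
  then have "(1 / (1 - q)) powr s \<le> (1 + 2 * q) powr s"
    using assms by (intro powr_mono2) auto
  also have "\<dots> \<le> (1 - 2 * q) * 1 powr s + 2 * q * 2 powr s" using * by (simp add: algebra_simps)
  also have "\<dots> \<le> 1 + 2 powr (s + 1) * q" using assms by (simp add: powr_add)
  finally show ?thesis .
qed

lemma ex_small_powr_mult_less_one:
  fixes g a :: real
  assumes "g < 1"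
  shows "\<exists>e>0. e \<le> 1/2 \<and> (\<forall>t. 0 < t \<longrightarrow> t \<le> e \<longrightarrow> (1 + 2 * t) powr a * g < (1 + g) / 2)"
proof -
  have "((\<lambda>t. (1 + 2 * t) powr a * g) \<longlongrightarrow> (1 + 2 * 0) powr a * g) (at_right 0)"
    by (intro tendsto_intros) auto
  then have "\<forall>\<^sub>F t in at_right 0. (1 + 2 * t) powr a * g < (1 + g) / 2"
    by (rule order_tendstoD) (use assms in simp)
  then obtain e where "e > 0" "\<And>t. 0 < t \<Longrightarrow> t < e \<Longrightarrow> (1 + 2 * t) powr a * g < (1 + g) / 2"
    by (auto simp: eventually_at_right_field)
  then show ?thesis by (intro exI[of _ "min (1/2) (e/2)"]) auto
qed

section \<open>The one-step recursion and its moments\<close>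

text \<open>If \<open>\<phi> = 1 + u\<close> is the passage factor of the previous site and \<open>r\<close> the ratio at the current one,
  the equation \<open>1 / \<phi>' = (1 - l) * (1 + r) - r * \<phi>\<close> for the new factor \<open>\<phi>'\<close> reads
  \<open>\<phi>' = 1 + q / (1 - q)\<close> with \<open>q = l + r * (l + u)\<close>. The recursion is killed, and stays at \<open>-1\<close>,
  once \<open>q\<close> exceeds \<open>k\<close>; then the factor \<open>1 + u\<close> is 0.\<close>

definition step :: "real \<Rightarrow> real \<Rightarrow> real \<Rightarrow> real \<Rightarrow> real" where
  "step l k u r = (if u < 0 then -1 else
     let q = l + r * (l + u) in if q \<le> k then q / (1 - q) else -1)"

text \<open>\<open>moment_s\<close> makes \<open>s\<close> the critical exponent;
  \<open>nontrivial\<close> makes the convexity inequalities strict after integration.\<close>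

locale ratio_law = prob_space N for N :: "'b measure" +
  fixes r :: "'b \<Rightarrow> real" and s :: real
  assumes r_measurable [measurable]: "r \<in> borel_measurable N"
    and r_nonneg: "0 \<le> r x"
    and s_gt_1: "1 < s"
    and integrable_powr_s: "integrable N (\<lambda>x. r x powr s)"
    and moment_s: "expectation (\<lambda>x. r x powr s) = 1"
    and nontrivial: "\<not> (AE x in N. r x = 1)"
begin

lemma integrable_powr:
  assumes "0 \<le> b" "b \<le> s"
  shows "integrable N (\<lambda>x. r x powr b)"
proof (rule Bochner_Integration.integrable_bound)
  show "integrable N (\<lambda>x. 1 + r x powr s)"
    using integrable_powr_s by auto
  have "t powr b \<le> 1 + t powr s" if "0 \<le> t" for t
  proof (cases "t \<le> 1")
    case True
    then have "t powr b \<le> 1" using that assms powr_mono2[of b t 1] by simp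
    then show ?thesis by (simp add: add_increasing2)
  next
    case False
    then have "t powr b \<le> t powr s" using assms by (intro powr_mono) auto
    then show ?thesis by simp
  qed
  then show "AE x in N. norm (r x powr b) \<le> norm (1 + r x powr s)"
    using r_nonneg by (auto simp: abs_of_nonneg add_nonneg_nonneg)
qed simp

lemma integrable_r: "integrable N r"
  using integrable_powr[of 1] s_gt_1 r_nonneg by simp

text \<open>A nonnegative function with mean zero vanishes almost surely, which would confine
  \<open>r\<close> to 1, the only zero of \<open>g\<close>.\<close>

lemma integral_pos_off_one:
  assumes int: "integrable N (\<lambda>x. g (r x))"
    and pos: "\<And>t. 0 \<le> t \<Longrightarrow> t \<noteq> 1 \<Longrightarrow> 0 < g t" and g1: "g 1 = (0::real)"
  shows "0 < expectation (\<lambda>x. g (r x))"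
proof -
  have nn: "0 \<le> g (r x)" for x
    using pos[of "r x"] g1 r_nonneg[of x] by (cases "r x = 1") auto
  have "expectation (\<lambda>x. g (r x)) \<noteq> 0"
  proof
    assume "expectation (\<lambda>x. g (r x)) = 0"
    then have "AE x in N. g (r x) = 0"
      using integral_nonneg_eq_0_iff_AE[OF int] nn by auto
    then have "AE x in N. r x = 1"
      by eventually_elim (use pos r_nonneg in force)
    then show False using nontrivial by simp
  qed
  moreover have "0 \<le> expectation (\<lambda>x. g (r x))" using nn by simp
  ultimately show ?thesis by simp
qed

lemma moment_less_one:
  assumes "0 < b" "b < s"
  shows "expectation (\<lambda>x. r x powr b) < 1"
proof -
  have int: "integrable N (\<lambda>x. r x powr b)" using assms by (intro integrable_powr) auto
  have "0 < expectation (\<lambda>x. 1 + b / s * (r x powr s - 1) - r x powr b)"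
    using powr_less_affine[of _ b s] assms int integrable_powr_s
    by (intro integral_pos_off_one[where g = "\<lambda>t. 1 + b / s * (t powr s - 1) - t powr b"]) auto
  also have "\<dots> = 1 - expectation (\<lambda>x. r x powr b)"
    using int integrable_powr_s moment_s by (simp add: prob_space)
  finally show ?thesis by simp
qed

definition "\<mu> = expectation r"

lemma mu_bounds: "0 \<le> \<mu>" "\<mu> < 1"
proof -
  show "0 \<le> \<mu>" using r_nonneg by (simp add: \<mu>_def)
  show "\<mu> < 1" using moment_less_one[of 1] s_gt_1 r_nonneg by (simp add: \<mu>_def)
qed

lemma integrable_powr_min: "integrable N (\<lambda>x. r x powr s * min (r x) 3)"
proof (rule Bochner_Integration.integrable_bound)
  show "integrable N (\<lambda>x. r x powr s * 3)" using integrable_powr_s by simp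
  show "AE x in N. norm (r x powr s * min (r x) 3) \<le> norm (r x powr s * 3)"
    using r_nonneg by (auto simp: abs_mult intro!: mult_left_mono)
qed simp

lemma truncated_moment_gt_one: "1 < expectation (\<lambda>x. r x powr s * min (r x) 3)"
proof -
  have "0 < expectation (\<lambda>x. r x powr s * (min (r x) 3 - 1) - (r x powr s - 1) / s)"
    using powr_mult_min_gt[of _ s] s_gt_1 integrable_powr_s integrable_powr_min
    by (intro integral_pos_off_one[where g = "\<lambda>t. t powr s * (min t 3 - 1) - (t powr s - 1) / s"])
      (auto simp: right_diff_distrib)
  also have "\<dots> = expectation (\<lambda>x. r x powr s * min (r x) 3) - 1"
    using integrable_powr_s integrable_powr_min moment_s
    by (simp add: right_diff_distrib prob_space)
  finally show ?thesis by simp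
qed

lemma q_nonneg: "0 < l \<Longrightarrow> 0 \<le> u \<Longrightarrow> l \<le> l + r x * (l + u)"
  using r_nonneg[of x] by simp

text \<open>Writing \<open>q = r * u + l * (1 + r)\<close> separates the part homogeneous in
  \<open>u\<close> from the source of order \<open>l\<close>.\<close>

lemma q_powr_le:
  assumes "0 < l" "0 \<le> u" "0 < b" "0 < e"
  shows "(l + r x * (l + u)) powr b
    \<le> (1 + e) powr b * (r x powr b * u powr b)
      + (1 + 1 / e) powr b * (l powr b * (2 powr b * (1 + r x powr b)))"
proof -
  have 1: "(1 + r x) powr b \<le> 2 powr b * 1 powr b + 2 powr b * r x powr b"
    using powr_add_le_weighted[of 1 "r x" b 1] assms r_nonneg[of x] by simp
  have "(l + r x * (l + u)) powr b = (r x * u + l * (1 + r x)) powr b"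
    by (simp add: algebra_simps)
  also have "\<dots> \<le> (1 + e) powr b * (r x * u) powr b + (1 + 1 / e) powr b * (l * (1 + r x)) powr b"
    using assms r_nonneg[of x] by (intro powr_add_le_weighted) auto
  also have "\<dots> = (1 + e) powr b * (r x powr b * u powr b)
      + (1 + 1 / e) powr b * (l powr b * (1 + r x) powr b)"
    using assms r_nonneg[of x] by (simp add: powr_mult)
  also have "\<dots> \<le> (1 + e) powr b * (r x powr b * u powr b)
      + (1 + 1 / e) powr b * (l powr b * (2 powr b * (1 + r x powr b)))"
    using 1 assms by (intro add_left_mono mult_left_mono) (auto simp: algebra_simps)
  finally show ?thesis .
qed

lemma integrable_q_powr:
  assumes "0 < l" "0 \<le> u" "0 < b" "b \<le> s"
  shows "integrable N (\<lambda>x. (l + r x * (l + u)) powr b)"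
proof (rule Bochner_Integration.integrable_bound)
  let ?f = "\<lambda>x. (1 + 1) powr b * (r x powr b * u powr b)
      + (1 + 1 / 1) powr b * (l powr b * (2 powr b * (1 + r x powr b)))"
  show "integrable N ?f"
    using integrable_powr[of b] assms by auto
  have "0 \<le> ?f x" for x by (intro add_nonneg_nonneg mult_nonneg_nonneg) auto
  then show "AE x in N. norm ((l + r x * (l + u)) powr b) \<le> norm (?f x)"
    using q_powr_le[OF assms(1-3), of 1] by (auto simp: abs_of_nonneg)
qed simp

text \<open>Below the critical exponent the moment of \<open>r\<close> is less than 1. The margin
  absorbs the factor \<open>(1 + 2 * e) powr b\<close>, so the power contracts up to the
  source.\<close>

lemma moment_q:
  assumes b: "0 < b" "b < s"
  shows "\<exists>g K. 0 \<le> g \<and> g < 1 \<and> 0 \<le> K \<and> (\<forall>l u. 0 < l \<longrightarrow> 0 \<le> u \<longrightarrow>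
    expectation (\<lambda>x. (l + r x * (l + u)) powr b) \<le> g * u powr b + K * l powr b)"
proof -
  let ?c = "expectation (\<lambda>x. r x powr b)"
  have c: "0 \<le> ?c" "?c < 1" using moment_less_one[OF b] by auto
  obtain e where e: "e > 0" "(1 + 2 * e) powr b * ?c < (1 + ?c) / 2"
    using ex_small_powr_mult_less_one[OF c(2), of b] by auto
  define K where "K = (1 + 1 / (2 * e)) powr b * (2 powr b * (1 + ?c))"
  show ?thesis
  proof (intro exI conjI allI impI)
    show "0 \<le> (1 + 2 * e) powr b * ?c" "(1 + 2 * e) powr b * ?c < 1" "0 \<le> K"
      using c e by (auto simp: K_def)
    fix l u :: real assume lu: "0 < l" "0 \<le> u"
    have int: "integrable N (\<lambda>x. r x powr b)" using b by (intro integrable_powr) auto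
    have "expectation (\<lambda>x. (l + r x * (l + u)) powr b)
      \<le> expectation (\<lambda>x. (1 + 2 * e) powr b * (r x powr b * u powr b)
      + (1 + 1 / (2 * e)) powr b * (l powr b * (2 powr b * (1 + r x powr b))))"
      using q_powr_le[of l u b "2 * e"] lu b e integrable_q_powr[of l u b] int
      by (intro integral_mono) auto
    also have "\<dots> = (1 + 2 * e) powr b * ?c * u powr b + K * l powr b"
      using int by (simp add: prob_space K_def algebra_simps)
    finally show "expectation (\<lambda>x. (l + r x * (l + u)) powr b)
      \<le> (1 + 2 * e) powr b * ?c * u powr b + K * l powr b" .
  qed
qed

lemma expectation_q: "expectation (\<lambda>x. l + r x * (l + u)) = l + \<mu> * (l + u)"
  using integrable_r by (simp add: prob_space \<mu>_def)

text \<open>There is no contraction at exponent \<open>s\<close>, so the coefficient of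
  \<open>u powr s\<close> must stay exactly 1. The tangent bound is used twice, for
  \<open>r * (l + u) + l\<close> and for \<open>u + l\<close>; \<open>moment_q\<close> controls its
  error at exponent \<open>s - 1/2\<close>.\<close>

lemma moment_q_s:
  "\<exists>K\<ge>0. \<forall>l u. 0 < l \<longrightarrow> 0 \<le> u \<longrightarrow>
    expectation (\<lambda>x. (l + r x * (l + u)) powr s)
      \<le> u powr s + K * (l powr (1/2) * u powr (s - 1/2) + l powr s)"
proof -
  let ?b = "s - 1/2"
  obtain g K where g: "0 \<le> g" "g < 1" "0 \<le> K" "\<And>l u. 0 < l \<Longrightarrow> 0 \<le> u \<Longrightarrow>
    expectation (\<lambda>x. (l + r x * (l + u)) powr ?b) \<le> g * u powr ?b + K * l powr ?b"
    using moment_q[of ?b] s_gt_1 by auto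
  let ?K = "s * (2 powr ?b + 1 + K)"
  show ?thesis
  proof (intro exI[of _ ?K] conjI allI impI)
    show "0 \<le> ?K" using g s_gt_1 by simp
    fix l u :: real assume lu: "0 < l" "0 \<le> u"
    have ls: "l powr (1/2) * l powr ?b = l powr s" using lu by (simp flip: powr_add)
    have pt: "(l + r x * (l + u)) powr s
      \<le> r x powr s * (l + u) powr s + s * l powr (1/2) * (l + r x * (l + u)) powr ?b" for x
      using powr_add_le_tangent[of "r x * (l + u)" l s] lu s_gt_1 r_nonneg[of x]
      by (simp add: powr_mult add.commute)
    have "expectation (\<lambda>x. (l + r x * (l + u)) powr s)
      \<le> expectation (\<lambda>x. r x powr s * (l + u) powr s + s * l powr (1/2) * (l + r x * (l + u)) powr ?b)"
      using lu pt integrable_powr_s integrable_q_powr[of l u s] integrable_q_powr[of l u ?b] s_gt_1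
      by (intro integral_mono) auto
    also have "\<dots> = (l + u) powr s + s * l powr (1/2) * expectation (\<lambda>x. (l + r x * (l + u)) powr ?b)"
      using lu integrable_powr_s integrable_q_powr[of l u ?b] s_gt_1 moment_s by simp
    also have "\<dots> \<le> (u powr s + s * l powr (1/2) * (l + u) powr ?b)
        + s * l powr (1/2) * (g * u powr ?b + K * l powr ?b)"
      using lu s_gt_1 g(4)[OF lu] powr_add_le_tangent[of u l s]
      by (intro add_mono mult_left_mono) (auto simp: add.commute)
    also have "\<dots> \<le> (u powr s + s * l powr (1/2) * (2 powr ?b * u powr ?b + 2 powr ?b * l powr ?b))
        + s * l powr (1/2) * (1 * u powr ?b + K * l powr ?b)"
      using lu s_gt_1 g powr_add_le_weighted[of u l ?b 1]
      by (intro add_mono mult_left_mono mult_right_mono order_refl) (auto simp: add.commute)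
    also have "\<dots> = u powr s + (s * (2 powr ?b + 1)) * (l powr (1/2) * u powr ?b)
        + (s * (2 powr ?b + K)) * (l powr (1/2) * l powr ?b)"
      by (simp add: algebra_simps)
    also have "\<dots> \<le> u powr s + ?K * (l powr (1/2) * u powr ?b) + ?K * (l powr (1/2) * l powr ?b)"
    proof -
      have "s * (2 powr ?b + 1) \<le> ?K" "s * (2 powr ?b + K) \<le> ?K"
        using g s_gt_1 by auto
      then show ?thesis by (intro add_mono mult_right_mono order_refl) auto
    qed
    finally show "expectation (\<lambda>x. (l + r x * (l + u)) powr s)
      \<le> u powr s + ?K * (l powr (1/2) * u powr ?b + l powr s)"
      unfolding ls by (simp add: algebra_simps)
  qed
qed

end

section \<open>Pointwise bounds for one step of the recursion\<close>

lemma step_measurable [measurable (raw)]: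
  assumes [measurable]: "f \<in> borel_measurable M" "g \<in> borel_measurable M"
  shows "(\<lambda>x. step l k (f x) (g x)) \<in> borel_measurable M"
  unfolding step_def Let_def by measurable

lemma step_cases:
  assumes "0 < l" "0 < k" "k \<le> 1/2" "0 \<le> r"
  obtains (dead) "step l k u r = -1"
    | (alive) "0 \<le> u" "l + r * (l + u) \<le> k" "step l k u r = (l + r * (l + u)) / (1 - (l + r * (l + u)))"
        "0 < step l k u r" "step l k u r \<le> (1 + 2 * k) * (l + r * (l + u))" "step l k u r \<le> 2 * k"
proof (cases "0 \<le> u \<and> l + r * (l + u) \<le> k")
  case False
  then show ?thesis by (intro dead) (auto simp: step_def Let_def)
next
  case True
  define q where "q = l + r * (l + u)"
  have q: "0 < q" "q \<le> k" using True assms by (auto simp: q_def add_pos_nonneg)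
  have st: "step l k u r = q / (1 - q)" using True by (auto simp: step_def Let_def q_def)
  \<comment> \<open>The aim is \<open>1 \<le> (1 + 2 * k) * (1 - q)\<close>, which bounds the
    nonlinear factor \<open>1 / (1 - q)\<close> by \<open>1 + 2 * k\<close>.\<close>
  have "k * (2 * q) \<le> k * 1" using q assms by (intro mult_left_mono) auto
  then have "1 \<le> 1 + 2 * k - q - k * (2 * q)" using q by linarith
  also have "\<dots> = (1 + 2 * k) * (1 - q)" by (simp add: algebra_simps)
  finally have "1 \<le> (1 + 2 * k) * (1 - q)" .
  then have "q * 1 \<le> q * ((1 + 2 * k) * (1 - q))" using q by (intro mult_left_mono) auto
  then have 1: "q / (1 - q) \<le> (1 + 2 * k) * q" using q assms by (simp add: pos_divide_le_eq mult_ac)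
  have "q / (1 - q) \<le> k / (1/2)" using q assms by (intro frac_le) auto
  then have 2: "q / (1 - q) \<le> 2 * k" by simp
  have "0 < q / (1 - q)" using q assms by simp
  then show ?thesis using True q 1 2 st unfolding q_def by (intro alive) simp_all
qed

text \<open>Replacing \<open>q\<close> by \<open>q / (1 - q)\<close> costs a factor
  \<open>1 + M * q\<close> with \<open>M = 2 powr (s + 1)\<close>. The condition on \<open>k\<close>
  gives \<open>2 * (M * q) \<le> z * (q / (6 * k))\<close>, so a fraction \<open>z\<close> of the
  negative term pays for it. The minimum with 1 keeps the right side of order
  \<open>q powr s\<close> for large \<open>q\<close>, where the same expression serves for killed
  steps.\<close>

lemma lyapunov_step_le:
  fixes q k c z s l b :: real
  assumes q: "0 < q" "q \<le> k" and k: "k \<le> 1/2" "12 * 2 powr (s + 1) * k \<le> z"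
    and s: "1 < s" and c: "0 \<le> c" and b: "0 \<le> b" "b \<le> s"
  shows "(q / (1 - q)) powr s * (2 - q / (1 - q) / (6 * k)) + c * (q / (1 - q)) powr b
    \<le> 2 * q powr s - (1 - z) * (q powr s * min (q / (6 * k)) 1) + c * (1 + z) * q powr b"
proof -
  define M w where "M = (2::real) powr (s + 1)" and "w = 1 / (1 - q)"
  have M: "0 \<le> M" by (simp add: M_def)
  have w: "1 \<le> w" using q k by (simp add: w_def)
  have qw: "q / (1 - q) = q * w" by (simp add: w_def)
  have ws: "w powr s \<le> 1 + M * q"
    using one_minus_powr_le[of q s] q k s by (simp add: w_def M_def)
  have "w powr b \<le> w powr s" using w b by (intro powr_mono) auto
  with ws have wb: "w powr b \<le> 1 + M * q" by simp
  have Mk: "12 * M * k \<le> z" using k by (simp add: M_def)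
  have "M * q \<le> M * k" "0 \<le> M * k" using M q by (auto intro: mult_left_mono)
  with Mk have Mq: "M * q \<le> z" by linarith
  have qk: "q / (6 * k) \<le> 1" "0 \<le> q / (6 * k)" using q by auto
  have "2 * (M * q) = 12 * M * k * (q / (6 * k))" using q by simp
  also have "\<dots> \<le> z * (q / (6 * k))" using Mk qk by (intro mult_right_mono)
  finally have Mq2: "2 * (M * q) \<le> z * (q / (6 * k))" .
  have fac: "(1 + M * q) * (2 - X) \<le> 2 - (1 - z) * X" if "2 * (M * q) \<le> z * X" "0 \<le> M * q * X" for X
    using that by (simp add: algebra_simps)
  have fac: "(1 + M * q) * (2 - q / (6 * k)) \<le> 2 - (1 - z) * (q / (6 * k))"
    using Mq2 M q by (intro fac) auto
  have "(q * w) powr s * (2 - q * w / (6 * k)) \<le> (q * w) powr s * (2 - q / (6 * k))"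
  proof (intro mult_left_mono diff_left_mono divide_right_mono)
    show "q \<le> q * w" using q w by simp
  qed (use q in auto)
  also have "\<dots> = q powr s * (w powr s * (2 - q / (6 * k)))"
    using q w by (simp add: powr_mult)
  also have "\<dots> \<le> q powr s * ((1 + M * q) * (2 - q / (6 * k)))"
    using ws qk by (intro mult_left_mono mult_right_mono) auto
  also have "\<dots> \<le> q powr s * (2 - (1 - z) * (q / (6 * k)))"
    using fac by (intro mult_left_mono) auto
  also have "\<dots> = 2 * q powr s - (1 - z) * (q powr s * min (q / (6 * k)) 1)"
    using qk by (simp add: min_def algebra_simps)
  finally have 1: "(q * w) powr s * (2 - q * w / (6 * k))
      \<le> 2 * q powr s - (1 - z) * (q powr s * min (q / (6 * k)) 1)" .
  have "c * (q * w) powr b = c * (q powr b * w powr b)" using q w by (simp add: powr_mult)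
  also have "\<dots> \<le> c * (q powr b * (1 + z))"
    using c wb Mq by (intro mult_left_mono) auto
  finally show ?thesis using 1 unfolding qw by (simp add: mult_ac)
qed

section \<open>Drift inequalities\<close>

context ratio_law
begin

text \<open>As \<open>H\<close> vanishes on killed states and is at most 1, its mean along the chain
  bounds the survival probability from below. The first drift condition is multiplicative, for sites
  that can be averaged freely; the last is an additive loss, for sites on which a given event may
  depend.\<close>

definition survival_fun :: "real \<Rightarrow> real \<Rightarrow> real \<Rightarrow> (real \<Rightarrow> real) \<Rightarrow> bool" where
  "survival_fun C l k H \<longleftrightarrow> H \<in> borel_measurable borel \<and> H 0 = 1 \<and> (\<forall>u<0. H u = 0) \<and>
     (\<forall>u. 0 \<le> H u \<and> H u \<le> 1) \<and>
     (\<forall>u\<le>2 * k. (1 - C * l powr s) * H u \<le> expectation (\<lambda>x. H (step l k u (r x)))) \<and>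
     (\<forall>u\<ge>0. u \<le> 2 * k \<longrightarrow> expectation (\<lambda>x. 1 - H (step l k u (r x))) \<le> C * (l + u))"

text \<open>With \<open>b = s - 1/2\<close>, the Lyapunov function is
  \<open>G u = u powr s * (2 - u / (6 * k)) + c * l powr (1/2) * u powr b\<close>. Since \<open>E[r powr s] = 1\<close>,
  the power \<open>u powr s\<close> is critical. The term with \<open>b < s\<close> has strictly negative drift and absorbs
  the source \<open>l\<close>; the term with exponent \<open>s + 1\<close>, whose drift is controlled by
  \<open>E[r powr s * min r 3] > 1\<close>, absorbs the nonlinearity \<open>q / (1 - q)\<close>.\<close>

lemma survival_drift:
  "\<exists>k1>0. \<forall>k. 0 < k \<longrightarrow> k \<le> k1 \<longrightarrow> (\<exists>C\<ge>0. \<exists>l0>0. \<forall>l. 0 < l \<longrightarrow> l \<le> l0 \<longrightarrow> (\<exists>H. survival_fun C l k H))"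
proof -
  define b where "b = s - 1/2"
  have b: "0 < b" "b < s" "0 \<le> b" "b \<le> s" using s_gt_1 by (auto simp: b_def)
  obtain g K3 where g: "0 \<le> g" "g < 1" "0 \<le> K3" and moment_b: "\<And>l u. 0 < l \<Longrightarrow> 0 \<le> u \<Longrightarrow>
    expectation (\<lambda>x. (l + r x * (l + u)) powr b) \<le> g * u powr b + K3 * l powr b"
    using moment_q[of b] b by auto
  obtain K2 where K2: "0 \<le> K2" and moment_s': "\<And>l u. 0 < l \<Longrightarrow> 0 \<le> u \<Longrightarrow>
    expectation (\<lambda>x. (l + r x * (l + u)) powr s)
      \<le> u powr s + K2 * (l powr (1/2) * u powr b + l powr s)"
    using moment_q_s unfolding b_def by blast
  define T where "T = expectation (\<lambda>x. r x powr s * min (r x) 3)"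
  have T: "1 < T" using truncated_moment_gt_one by (simp add: T_def)
  \<comment> \<open>The budget \<open>z\<close> has to satisfy \<open>(1 - z) * T \<ge> 1\<close>,
    so that the negative term of exponent \<open>s + 1\<close> reproduces at least itself, and
    \<open>(1 + z) * g < 1\<close>, so that exponent \<open>b\<close> still contracts.\<close>
  define z where "z = min (1/2) (min (1 - 1 / T) ((1 - g) / 2))"
  have z: "0 < z" "z \<le> 1/2" "z \<le> 1 - 1 / T" "z \<le> (1 - g) / 2"
    using T g unfolding z_def by (auto simp only: min_less_iff_conj min.cobounded1 min.coboundedI2 min.cobounded2) auto
  have zT: "1 \<le> (1 - z) * T" using z(3) T by (simp add: field_simps)
  have "(1 + z) * g \<le> g + z" using g z mult_left_mono[of g 1 z] by (simp add: algebra_simps)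
  then have zg: "(1 + z) * g < 1" using z(4) g by argo
  \<comment> \<open>\<open>c\<close> solves \<open>c = 2 * K2 + 1 + c * ((1 + z) * g)\<close>: the
    contracting term pays the critical error \<open>2 * K2 * l powr (1/2) * u powr b\<close> and
    leaves a gain of \<open>l powr (1/2) * u powr b\<close>.\<close>
  define c where "c = (2 * K2 + 1) / (1 - (1 + z) * g)"
  have c0: "0 \<le> c" using zg K2 by (simp add: c_def)
  have "c * (1 - (1 + z) * g) = 2 * K2 + 1" using zg by (simp add: c_def)
  then have c: "c = 2 * K2 + 1 + c * ((1 + z) * g)" by (simp add: algebra_simps)
  define C1 where "C1 = 2 * K2 + 2 * c * K3 + 1"
  have C1: "0 < C1" using K2 c0 g by (simp add: C1_def add_nonneg_pos)
  define k1 where "k1 = z / (12 * 2 powr (s + 1))"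
  have k1: "0 < k1" using z by (simp add: k1_def)
  show ?thesis
  proof (rule exI[of _ k1], rule conjI[OF k1], rule allI, rule impI, rule impI)
    fix k assume k: "0 < k" "k \<le> k1"
    have kz: "12 * 2 powr (s + 1) * k \<le> z" using k by (simp add: k1_def field_simps)
    have "1 * k \<le> 12 * 2 powr (s + 1) * k"
      using k s_gt_1 ge_one_powr_ge_zero[of 2 "s + 1"] by (intro mult_right_mono) auto
    with kz z have k12: "k \<le> 1/2" by linarith
    \<comment> \<open>Only for \<open>u \<le> A * l\<close> can the source exceed the gain. There
      \<open>G u \<le> D * l powr s\<close>, and \<open>l0\<close> makes this at most
      \<open>k powr s / 2\<close>.\<close>
    define A where "A = C1 powr (1 / b)"
    have A: "0 < A" using C1 by (simp add: A_def)
    define D where "D = 2 * A powr s + c * A powr b + 1"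
    have D: "0 < D" using c0 by (simp add: D_def add_nonneg_pos)
    define C where "C = Max {2 * C1 / k powr s, 2 * (2 + 2 * c) / k powr s, 2}"
    have C: "2 * C1 / k powr s \<le> C" "2 * (2 + 2 * c) / k powr s \<le> C" "2 \<le> C"
      unfolding C_def by (intro Max_ge; simp)+
    then have C: "2 * C1 / k powr s \<le> C" "2 * (2 + 2 * c) / k powr s \<le> C" "2 \<le> C" "0 \<le> C"
      by auto
    define l0 where "l0 = k / (2 * D) powr (1 / s)"
    have l0: "0 < l0" using k D by (simp add: l0_def)
    show "\<exists>C\<ge>0. \<exists>l0>0. \<forall>l. 0 < l \<longrightarrow> l \<le> l0 \<longrightarrow> (\<exists>H. survival_fun C l k H)"
    proof (rule exI[of _ C], rule conjI[OF C(4)], rule exI[of _ l0], rule conjI[OF l0],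
        rule allI, rule impI, rule impI)
      fix l assume l: "0 < l" "l \<le> l0"
      have "l powr s \<le> l0 powr s" using l s_gt_1 by (intro powr_mono2) auto
      also have "\<dots> = k powr s / (2 * D)"
        using k D s_gt_1 by (simp add: l0_def powr_divide powr_powr)
      finally have lD: "D * l powr s \<le> k powr s / 2" using D by (simp add: field_simps)
      define h where "h = l powr (1/2)"
      have h: "0 < h" "h * l powr b = l powr s"
        using l by (simp_all add: h_def b_def flip: powr_add)
      define G where "G u = u powr s * (2 - u / (6 * k)) + c * h * u powr b" for u
      define H where "H u = (if u < 0 then 0 else max 0 (min 1 (1 - G u / k powr s)))" for u
      \<comment> \<open>\<open>F q\<close> dominates \<open>G\<close> after a step with
        \<open>q \<le> k\<close> and is at least \<open>k powr s\<close> for \<open>q > k\<close>,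
        so \<open>1 - F q / k powr s\<close> lies below \<open>H\<close> after the step in both
        cases.\<close>
      define F where "F q = 2 * q powr s - (1 - z) * (q powr s * min (q / (6 * k)) 1)
          + c * h * (1 + z) * q powr b" for q
      let ?q = "\<lambda>u x. l + r x * (l + u)"
      have H01: "0 \<le> H u" "H u \<le> 1" for u by (auto simp: H_def)
      have H_meas [measurable]: "H \<in> borel_measurable borel"
        unfolding H_def G_def by measurable
      have intH: "integrable N (\<lambda>x. H (step l k u (r x)))" for u
        using H01 by (intro integrable_const_bound[where B = 1]) auto
      have q_ge: "l \<le> ?q u x" if "0 \<le> u" for u x
        using q_nonneg[OF l(1) that] .
      have int_min: "integrable N (\<lambda>x. ?q u x powr s * min (?q u x / (6 * k)) 1)"
        if "0 \<le> u" for u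
      proof (rule Bochner_Integration.integrable_bound)
        show "integrable N (\<lambda>x. ?q u x powr s)"
          using integrable_q_powr[of l u s] l that s_gt_1 by auto
        show "AE x in N. norm (?q u x powr s * min (?q u x / (6 * k)) 1) \<le> norm (?q u x powr s)"
        proof (rule AE_I2)
          fix x
          have "0 \<le> ?q u x / (6 * k)" using q_ge[OF that, of x] l k by auto
          then show "norm (?q u x powr s * min (?q u x / (6 * k)) 1) \<le> norm (?q u x powr s)"
            by (auto simp: abs_mult mult_left_le)
        qed
      qed simp
      have intF: "integrable N (\<lambda>x. F (?q u x))" if "0 \<le> u" for u
        unfolding F_def
        using integrable_q_powr[of l u s] integrable_q_powr[of l u b] int_min[OF that] l that b s_gt_1
        by auto
      have F_le_q: "F q \<le> (2 + 2 * c) * q powr s" if "l \<le> q" for q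
      proof -
        \<comment> \<open>As \<open>l \<le> q\<close>, the factor \<open>h\<close> is at most
          \<open>q powr (1/2)\<close>, which restores the full exponent \<open>s\<close>.\<close>
        have "h * q powr b \<le> q powr (1/2) * q powr b"
          unfolding h_def using l that by (intro mult_right_mono powr_mono2) auto
        also have "\<dots> = q powr s" by (simp add: b_def flip: powr_add)
        finally have "c * (1 + z) * (h * q powr b) \<le> c * 2 * q powr s"
          using c0 z h by (intro mult_mono mult_left_mono) auto
        moreover have "0 \<le> (1 - z) * (q powr s * min (q / (6 * k)) 1)"
          using z that l k by (intro mult_nonneg_nonneg) auto
        ultimately show ?thesis by (simp add: F_def algebra_simps)
      qed
      have stepF: "1 - F (?q u x) / k powr s \<le> H (step l k u (r x))" if u: "0 \<le> u" for u x
      proof (cases "?q u x \<le> k")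
        case True
        let ?p = "?q u x"
        have st: "step l k u (r x) = ?p / (1 - ?p)" using True u by (simp add: step_def Let_def)
        have p: "0 < ?p" using q_ge[OF u, of x] l by linarith
        then have "0 \<le> ?p / (1 - ?p)" using True k12 by simp
        moreover have "G (?p / (1 - ?p)) \<le> F ?p"
          using lyapunov_step_le[OF p True k12 kz s_gt_1 _ b(3,4), of "c * h"] c0 h
          by (simp add: G_def F_def mult_ac)
        then have "1 - F ?p / k powr s \<le> 1 - G (?p / (1 - ?p)) / k powr s"
          by (intro diff_left_mono divide_right_mono) auto
        moreover have "0 \<le> F ?p"
        proof -
          have "min (?p / (6 * k)) 1 \<le> 1" "0 \<le> min (?p / (6 * k)) 1" using p k by auto
          then have "(1 - z) * (?p powr s * min (?p / (6 * k)) 1) \<le> 1 * (?p powr s * 1)"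
            using z by (intro mult_mono mult_left_mono) auto
          moreover have "0 \<le> c * h * (1 + z) * ?p powr b" using c0 h z by simp
          ultimately show ?thesis unfolding F_def using powr_ge_zero[of ?p s] by linarith
        qed
        then have "1 - F ?p / k powr s \<le> 1" by simp
        ultimately show ?thesis unfolding st H_def by auto
      next
        case False
        let ?p = "?q u x"
        have p: "k < ?p" using False by simp
        have "min (?p / (6 * k)) 1 \<le> 1" "0 \<le> min (?p / (6 * k)) 1" using p k by auto
        then have "(1 - z) * (?p powr s * min (?p / (6 * k)) 1) \<le> 1 * (?p powr s * 1)"
          using z by (intro mult_mono mult_left_mono) auto
        moreover have "0 \<le> c * h * (1 + z) * ?p powr b" using c0 h z by simp
        moreover have "k powr s \<le> ?p powr s" using p k s_gt_1 by (intro powr_mono2) auto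
        ultimately have "k powr s \<le> F ?p" unfolding F_def by linarith
        then have "1 \<le> F ?p / k powr s" using k by simp
        then show ?thesis using H01(1)[of "step l k u (r x)"] by linarith
      qed
      have EF: "expectation (\<lambda>x. F (?q u x)) \<le> G u + C1 * l powr s - h * u powr b"
        if u: "0 \<le> u" "u \<le> 2 * k" for u
      proof -
        \<comment> \<open>Because \<open>u \<le> 2 * k\<close>, the cap 3 keeps
          \<open>u / (6 * k) * min r 3\<close> at most 1, so the truncated moment \<open>T\<close>
          bounds the negative term from below.\<close>
        have low: "u powr s * (u / (6 * k)) * T \<le> expectation (\<lambda>x. ?q u x powr s * min (?q u x / (6 * k)) 1)"
        proof -
          have "u powr s * (u / (6 * k)) * T
              = expectation (\<lambda>x. u powr s * (u / (6 * k)) * (r x powr s * min (r x) 3))"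
            unfolding T_def by simp
          also have "\<dots> \<le> expectation (\<lambda>x. ?q u x powr s * min (?q u x / (6 * k)) 1)"
          proof (intro integral_mono int_min u integrable_mult_right integrable_powr_min)
            fix x
            have rq: "r x * u \<le> ?q u x" using l r_nonneg[of x] by (simp add: algebra_simps)
            have "u / (6 * k) * r x \<le> ?q u x / (6 * k)"
              using rq k by (simp add: divide_right_mono mult.commute)
            moreover have "u / (6 * k) * 3 \<le> 1" using u k by simp
            moreover have "u / (6 * k) * min (r x) 3 = min (u / (6 * k) * r x) (u / (6 * k) * 3)"
              using u k by (intro min_mult_distrib_left[THEN trans]) auto
            ultimately have 1: "u / (6 * k) * min (r x) 3 \<le> min (?q u x / (6 * k)) 1"
              by linarith
            have 2: "(r x * u) powr s \<le> ?q u x powr s"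
              using rq u r_nonneg[of x] s_gt_1 by (intro powr_mono2) auto
            have "u powr s * (u / (6 * k)) * (r x powr s * min (r x) 3)
                = (r x * u) powr s * (u / (6 * k) * min (r x) 3)"
              using u r_nonneg[of x] by (simp add: powr_mult)
            also have "\<dots> \<le> ?q u x powr s * min (?q u x / (6 * k)) 1"
              using 1 2 u k r_nonneg[of x] by (intro mult_mono) auto
            finally show "u powr s * (u / (6 * k)) * (r x powr s * min (r x) 3)
                \<le> ?q u x powr s * min (?q u x / (6 * k)) 1" .
          qed
          finally show ?thesis .
        qed
        have "u powr s * (u / (6 * k)) * 1 \<le> u powr s * (u / (6 * k)) * ((1 - z) * T)"
          using zT u k by (intro mult_left_mono) auto
        also have "\<dots> = (1 - z) * (u powr s * (u / (6 * k)) * T)" by simp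
        also have "\<dots> \<le> (1 - z) * expectation (\<lambda>x. ?q u x powr s * min (?q u x / (6 * k)) 1)"
          using low z by (intro mult_left_mono) auto
        finally have low': "u powr s * (u / (6 * k))
            \<le> (1 - z) * expectation (\<lambda>x. ?q u x powr s * min (?q u x / (6 * k)) 1)" by simp
        have "expectation (\<lambda>x. F (?q u x)) = 2 * expectation (\<lambda>x. ?q u x powr s)
            - (1 - z) * expectation (\<lambda>x. ?q u x powr s * min (?q u x / (6 * k)) 1)
            + c * h * (1 + z) * expectation (\<lambda>x. ?q u x powr b)"
          unfolding F_def
          using integrable_q_powr[of l u s] integrable_q_powr[of l u b] int_min[OF u(1)] l u b s_gt_1
          by simp
        also have "\<dots> \<le> 2 * (u powr s + K2 * (h * u powr b + l powr s)) - u powr s * (u / (6 * k))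
            + c * h * (1 + z) * (g * u powr b + K3 * l powr b)"
          using low' moment_b[OF l(1) u(1)] moment_s'[OF l(1) u(1)] c0 h z unfolding h_def[symmetric]
          by (intro add_mono diff_mono mult_left_mono) auto
        also have "\<dots> = 2 * u powr s + 2 * K2 * h * u powr b - u powr s * (u / (6 * k))
            + c * ((1 + z) * g) * (h * u powr b) + 2 * K2 * l powr s + (1 + z) * (c * K3 * (h * l powr b))"
          by (simp add: algebra_simps)
        also have "\<dots> \<le> 2 * u powr s + 2 * K2 * h * u powr b - u powr s * (u / (6 * k))
            + c * ((1 + z) * g) * (h * u powr b) + 2 * K2 * l powr s + 2 * (c * K3 * l powr s)"
          unfolding h(2) using z c0 g by (intro add_left_mono mult_right_mono) auto
        also have "\<dots> = G u + (C1 - 1) * l powr s + (2 * K2 + c * ((1 + z) * g) - c) * (h * u powr b)"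
          by (simp add: G_def C1_def algebra_simps)
        also have "2 * K2 + c * ((1 + z) * g) - c = -1" using c by linarith
        also have "(C1 - 1) * l powr s \<le> C1 * l powr s" by (intro mult_right_mono) auto
        finally show ?thesis by simp
      qed
      have drift: "(1 - C * l powr s) * H u \<le> expectation (\<lambda>x. H (step l k u (r x)))"
        if u: "u \<le> 2 * k" for u
      proof (cases "H u = 0")
        case True
        then show ?thesis using H01 by (simp add: integral_nonneg_AE)
      next
        case False
        then have u0: "0 \<le> u" by (auto simp: H_def split: if_splits)
        have Hu: "H u \<le> 1 - G u / k powr s"
          using False u0 by (auto simp: H_def)
        have "1 - (G u + C1 * l powr s - h * u powr b) / k powr s
            \<le> 1 - expectation (\<lambda>x. F (?q u x)) / k powr s"
          using EF[OF u0 u] by (intro diff_left_mono divide_right_mono) auto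
        also have "\<dots> = expectation (\<lambda>x. 1 - F (?q u x) / k powr s)"
          using intF[OF u0] by (simp add: prob_space)
        also have "\<dots> \<le> expectation (\<lambda>x. H (step l k u (r x)))"
          using stepF[OF u0] intF[OF u0] intH by (intro integral_mono) auto
        finally have E: "1 - (G u + C1 * l powr s - h * u powr b) / k powr s
            \<le> expectation (\<lambda>x. H (step l k u (r x)))" .
        have CH: "0 \<le> C * l powr s * H u" using C H01[of u] by simp
        \<comment> \<open>Either the gain covers the source, or \<open>u\<close> is of order
          \<open>l\<close> and \<open>H u \<ge> 1/2\<close> turns the additive source into a
          relative loss.\<close>
        show ?thesis
        proof (cases "C1 * l powr s \<le> h * u powr b")
          case True
          then have "1 - G u / k powr s \<le> 1 - (G u + C1 * l powr s - h * u powr b) / k powr s"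
            by (intro diff_left_mono divide_right_mono) auto
          with E Hu CH show ?thesis by (simp add: algebra_simps)
        next
          case False
          then have "h * u powr b < h * (C1 * l powr b)" by (simp add: h(2)[symmetric] mult_ac)
          then have ub: "u powr b < C1 * l powr b" using h by simp
          have "u = (u powr b) powr (1 / b)" using u0 b by (simp add: powr_powr)
          also have "\<dots> \<le> (C1 * l powr b) powr (1 / b)" using ub b by (intro powr_mono2) auto
          also have "\<dots> = A * l" using C1 l b by (simp add: powr_mult powr_powr A_def)
          finally have uA: "u \<le> A * l" .
          have us: "u powr s \<le> A powr s * l powr s" "u powr b \<le> A powr b * l powr b"
            using powr_mono2[OF _ u0 uA, of s] powr_mono2[OF _ u0 uA, of b] A l b s_gt_1
            by (auto simp: powr_mult)
          have "u powr s * (2 - u / (6 * k)) \<le> u powr s * 2"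
            using u0 k by (intro mult_left_mono) auto
          also have "\<dots> \<le> 2 * A powr s * l powr s" using us by simp
          finally have "G u \<le> 2 * A powr s * l powr s + c * h * (A powr b * l powr b)"
            unfolding G_def using us c0 h by (intro add_mono mult_left_mono) auto
          also have "\<dots> = 2 * A powr s * l powr s + c * A powr b * (h * l powr b)" by simp
          also have "\<dots> \<le> D * l powr s" unfolding h(2) D_def by (simp add: algebra_simps)
          also have "\<dots> \<le> k powr s / 2" by (rule lD)
          finally have "G u / k powr s \<le> 1/2" using k by (simp add: field_simps)
          moreover have "0 \<le> G u"
            unfolding G_def using u0 u k c0 h by (intro add_nonneg_nonneg mult_nonneg_nonneg) (auto simp: field_simps)
          ultimately have half: "1/2 \<le> H u" using u0 k by (auto simp: H_def)
          have "C1 * l powr s / k powr s = (2 * C1 / k powr s) * l powr s * (1/2)" by simp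
          also have "\<dots> \<le> C * l powr s * H u"
            using C half C1 by (intro mult_mono) auto
          finally have "H u - C * l powr s * H u \<le> 1 - G u / k powr s - C1 * l powr s / k powr s"
            using Hu by linarith
          also have "\<dots> \<le> 1 - (G u + C1 * l powr s - h * u powr b) / k powr s"
            using h by (simp add: add_divide_distrib diff_divide_distrib)
          finally show ?thesis using E by (simp add: algebra_simps)
        qed
      qed
      have loss: "expectation (\<lambda>x. 1 - H (step l k u (r x))) \<le> C * (l + u)"
        if u: "0 \<le> u" "u \<le> 2 * k" for u
      proof -
        \<comment> \<open>The loss is linear in \<open>q\<close>: for \<open>q \<le> 1\<close>
          because \<open>q powr s \<le> q\<close>, and for \<open>q > 1\<close> because
          \<open>C \<ge> 2\<close> makes the right side at least 1.\<close>
        have pt: "1 - H (step l k u (r x)) \<le> C / 2 * ?q u x" for x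
        proof (cases "?q u x \<le> 1")
          case True
          have q: "0 < ?q u x" using q_ge[OF u(1), of x] l by linarith
          have "?q u x powr s \<le> ?q u x powr 1" using True q s_gt_1 by (intro powr_mono') auto
          then have qs: "?q u x powr s \<le> ?q u x" using q by simp
          have "1 - H (step l k u (r x)) \<le> F (?q u x) / k powr s"
            using stepF[OF u(1), of x] by simp
          also have "\<dots> \<le> ((2 + 2 * c) * ?q u x) / k powr s"
          proof (rule divide_right_mono)
            have "(2 + 2 * c) * ?q u x powr s \<le> (2 + 2 * c) * ?q u x"
              using qs c0 by (intro mult_left_mono) auto
            then show "F (?q u x) \<le> (2 + 2 * c) * ?q u x"
              using F_le_q[OF q_ge[OF u(1), of x]] by linarith
          qed simp
          also have "\<dots> = (2 * (2 + 2 * c) / k powr s) / 2 * ?q u x"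
          proof -
            have "X * y / K = (2 * X / K) / 2 * y" for X y K :: real by simp
            then show ?thesis .
          qed
          also have "\<dots> \<le> C / 2 * ?q u x"
            using C q by (intro mult_right_mono divide_right_mono) auto
          finally show ?thesis .
        next
          case False
          then have "1 * 1 \<le> C / 2 * ?q u x" using C by (intro mult_mono) auto
          then show ?thesis using H01(1)[of "step l k u (r x)"] by linarith
        qed
        have "expectation (\<lambda>x. 1 - H (step l k u (r x))) \<le> expectation (\<lambda>x. C / 2 * ?q u x)"
          using pt intH integrable_r by (intro integral_mono) auto
        also have "\<dots> = C / 2 * (l + \<mu> * (l + u))" by (simp add: expectation_q)
        also have "\<dots> \<le> C / 2 * (2 * (l + u))"
        proof (rule mult_left_mono)
          have "\<mu> * (l + u) \<le> 1 * (l + u)" using mu_bounds l u by (intro mult_right_mono) auto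
          then show "l + \<mu> * (l + u) \<le> 2 * (l + u)" using u by simp
        qed (use C in auto)
        also have "\<dots> = C * (l + u)" by simp
        finally show ?thesis .
      qed
      show "\<exists>H. survival_fun C l k H"
        using H_meas H01 drift loss s_gt_1 b
        by (intro exI[of _ H]) (auto simp: survival_fun_def H_def G_def)
    qed
  qed
qed

text \<open>The witness is \<open>f u = 1 + A * u + B * u powr p\<close> with \<open>A = \<mu> / (1 - \<mu>)\<close>, so that \<open>(1 + A) * \<mu> = A\<close>
  makes the linear terms reproduce. Dead states drop out through the factor \<open>1 + u = 0\<close>.\<close>

lemma passage_drift:
  assumes p: "1 < p" "p < s" "p \<le> 2"
  shows "\<exists>k1>0. \<forall>k. 0 < k \<longrightarrow> k \<le> k1 \<longrightarrow> (\<exists>C\<ge>0. \<exists>D. \<forall>l. 0 < l \<longrightarrow>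
    (\<exists>f. f \<in> borel_measurable borel \<and> (\<forall>u\<ge>0. 1 \<le> f u) \<and> (\<forall>u\<le>2 * k. 0 \<le> f u \<and> f u \<le> D) \<and>
     (\<forall>u\<le>2 * k. expectation (\<lambda>x. (1 + step l k u (r x)) * f (step l k u (r x)))
        \<le> (1 + l * ((1 + \<mu>) / (1 - \<mu>)) + C * l powr p) * f u)))"
proof -
  obtain g K where g: "0 \<le> g" "g < 1" "0 \<le> K" and moment_p: "\<And>l u. 0 < l \<Longrightarrow> 0 \<le> u \<Longrightarrow>
    expectation (\<lambda>x. (l + r x * (l + u)) powr p) \<le> g * u powr p + K * l powr p"
    using moment_q[of p] p by auto
  obtain k1 where k1: "0 < k1" "k1 \<le> 1/2"
    and kg: "\<And>t. 0 < t \<Longrightarrow> t \<le> k1 \<Longrightarrow> (1 + 2 * t) powr (p + 1) * g < (1 + g) / 2"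
    using ex_small_powr_mult_less_one[OF g(2), of "p + 1"] by auto
  define A where "A = \<mu> / (1 - \<mu>)"
  have A: "0 \<le> A" "1 + A = 1 / (1 - \<mu>)" "(1 + A) * \<mu> = A"
    using mu_bounds by (auto simp: A_def field_simps)
  \<comment> \<open>The summands come from \<open>w \<le> q + 2 * q powr p\<close> in the term
    \<open>(1 + A) * w\<close> and from \<open>w * w \<le> 4 * q powr p\<close> in
    \<open>A * (w * w)\<close>, where \<open>w = q / (1 - q)\<close>. \<open>B\<close> solves
    \<open>c0 * g + B * ((1 + g) / 2) = B\<close>, so the power term reproduces as well.\<close>
  define c0 where "c0 = 2 * (1 + A) + 4 * A"
  have c0: "0 \<le> c0" using A by (simp add: c0_def)
  define B where "B = c0 * g / (1 - (1 + g) / 2)"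
  have B0: "0 \<le> B" using c0 g by (simp add: B_def)
  have "B * (1 - (1 + g) / 2) = c0 * g" using g by (simp add: B_def)
  then have B: "c0 * g + B * ((1 + g) / 2) = B" by (simp add: algebra_simps)
  show ?thesis
  proof (rule exI[of _ k1], rule conjI[OF k1(1)], rule allI, rule impI, rule impI)
    fix k assume k: "0 < k" "k \<le> k1"
    then have k12: "k \<le> 1/2" using k1 by simp
    define E where "E = c0 + B * (1 + 2 * k) powr (p + 1)"
    have E0: "0 \<le> E" using c0 B0 by (simp add: E_def)
    have "E * g = c0 * g + B * ((1 + 2 * k) powr (p + 1) * g)" by (simp add: E_def algebra_simps)
    also have "\<dots> \<le> c0 * g + B * ((1 + g) / 2)"
      using kg[OF k] B0 by (intro add_left_mono mult_left_mono) auto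
    finally have Eg: "E * g \<le> B" using B by simp
    show "\<exists>C\<ge>0. \<exists>D. \<forall>l. 0 < l \<longrightarrow>
      (\<exists>f. f \<in> borel_measurable borel \<and> (\<forall>u\<ge>0. 1 \<le> f u) \<and> (\<forall>u\<le>2 * k. 0 \<le> f u \<and> f u \<le> D) \<and>
       (\<forall>u\<le>2 * k. expectation (\<lambda>x. (1 + step l k u (r x)) * f (step l k u (r x)))
          \<le> (1 + l * ((1 + \<mu>) / (1 - \<mu>)) + C * l powr p) * f u))"
    proof (rule exI[of _ "E * K"], rule conjI[OF mult_nonneg_nonneg[OF E0 g(3)]],
        rule exI[of _ "1 + A * (2 * k) + B * (2 * k) powr p"], rule allI, rule impI)
      fix l :: real assume l: "0 < l"
      let ?q = "\<lambda>u x. l + r x * (l + u)"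
      define f where "f u = 1 + A * max 0 u + B * max 0 u powr p" for u
      have f_meas [measurable]: "f \<in> borel_measurable borel" unfolding f_def by measurable
      have f1: "1 \<le> f u" for u using A B0 by (simp add: f_def)
      have fD: "f u \<le> 1 + A * (2 * k) + B * (2 * k) powr p" if "u \<le> 2 * k" for u
        unfolding f_def using that k A B0 p
        by (intro add_mono mult_left_mono powr_mono2) auto
      have drift: "expectation (\<lambda>x. (1 + step l k u (r x)) * f (step l k u (r x)))
          \<le> (1 + l * ((1 + \<mu>) / (1 - \<mu>)) + E * K * l powr p) * f u" if u: "u \<le> 2 * k" for u
      proof (cases "0 \<le> u")
        case False
        have "0 \<le> (1 + l * ((1 + \<mu>) / (1 - \<mu>)) + E * K * l powr p) * f u"
          using f1[of u] E0 g l mu_bounds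
          by (intro mult_nonneg_nonneg add_nonneg_nonneg divide_nonneg_nonneg) auto
        then show ?thesis using False by (simp add: step_def)
      next
        case True
        have pt: "(1 + step l k u (r x)) * f (step l k u (r x)) \<le> 1 + (1 + A) * ?q u x + E * ?q u x powr p" for x
        proof (cases rule: step_cases[OF l k(1) k12 r_nonneg[of x], of u, case_names dead alive])
          case dead
          have "l \<le> ?q u x" using q_nonneg[OF l True] .
          then have "0 \<le> ?q u x" using l by linarith
          then have "0 \<le> 1 + (1 + A) * ?q u x + E * ?q u x powr p"
            using A(1) E0 by (intro add_nonneg_nonneg[OF add_nonneg_nonneg] mult_nonneg_nonneg) simp_all
          then show ?thesis using dead by simp
        next
          case alive
          define q w where "q = ?q u x" and "w = step l k u (r x)"
          have q: "0 < q" "q \<le> k" using alive q_nonneg[OF l True, of x] l by (auto simp: q_def)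
          have w: "0 < w" "w \<le> (1 + 2 * k) * q" "w \<le> 2 * k" using alive by (auto simp: w_def q_def)
          have wq: "w = q / (1 - q)" using alive by (simp add: w_def q_def)
          have q2: "q\<^sup>2 \<le> q powr p"
          proof -
            have "q powr 2 \<le> q powr p" using q k12 p by (intro powr_mono') auto
            then show ?thesis using q by (simp add: powr_numeral)
          qed
          have "q * (1 - q) * (1 + 2 * q) - q = q * q * (1 - 2 * q)" by (simp add: algebra_simps)
          also have "\<dots> \<ge> 0" using q k12 by (intro mult_nonneg_nonneg) auto
          finally have "w \<le> q * (1 + 2 * q)"
            unfolding wq using q k12 by (simp add: pos_divide_le_eq mult_ac)
          then have w1: "w \<le> q + 2 * q powr p"
            using q2 by (simp add: algebra_simps power2_eq_square)
          have "w \<le> 2 * q"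
          proof -
            have "(1 + 2 * k) * q \<le> 2 * q" using q k12 by (intro mult_right_mono) auto
            then show ?thesis using w by simp
          qed
          then have "w * w \<le> (2 * q) * (2 * q)" using w q by (intro mult_mono) auto
          then have w2: "w * w \<le> 4 * q powr p" using q2 by (simp add: power2_eq_square)
          have "w powr p \<le> ((1 + 2 * k) * q) powr p" using w p by (intro powr_mono2) auto
          then have "(1 + w) * w powr p \<le> (1 + 2 * k) * ((1 + 2 * k) powr p * q powr p)"
            using w k q by (intro mult_mono) (auto simp: powr_mult)
          then have wp: "(1 + w) * w powr p \<le> (1 + 2 * k) powr (p + 1) * q powr p"
            using k by (simp add: powr_add mult_ac)
          have "(1 + w) * f w = 1 + (1 + A) * w + A * (w * w) + B * ((1 + w) * w powr p)"
            using w by (simp add: f_def algebra_simps)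
          also have "\<dots> \<le> 1 + (1 + A) * (q + 2 * q powr p) + A * (4 * q powr p)
              + B * ((1 + 2 * k) powr (p + 1) * q powr p)"
            using w1 w2 wp A(1) B0 by (intro add_mono mult_left_mono) simp_all
          also have "\<dots> = 1 + (1 + A) * q + E * q powr p"
            by (simp add: E_def c0_def algebra_simps)
          finally show ?thesis unfolding w_def q_def .
        qed
        have bd: "integrable N (\<lambda>x. (1 + step l k u (r x)) * f (step l k u (r x)))"
        proof (rule integrable_const_bound[where B = "(1 + 2 * k) * (1 + A * (2 * k) + B * (2 * k) powr p)"])
          show "AE x in N. norm ((1 + step l k u (r x)) * f (step l k u (r x)))
              \<le> (1 + 2 * k) * (1 + A * (2 * k) + B * (2 * k) powr p)"
          proof (rule AE_I2)
            fix x
            have "-1 \<le> step l k u (r x)" "step l k u (r x) \<le> 2 * k"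
              using step_cases[OF l k(1) k12 r_nonneg[of x], of u] k by force+
            then show "norm ((1 + step l k u (r x)) * f (step l k u (r x)))
                \<le> (1 + 2 * k) * (1 + A * (2 * k) + B * (2 * k) powr p)"
              unfolding real_norm_def abs_mult using fD[of "step l k u (r x)"] f1[of "step l k u (r x)"]
              by (intro mult_mono) auto
          qed
        qed simp
        have "expectation (\<lambda>x. (1 + step l k u (r x)) * f (step l k u (r x)))
            \<le> expectation (\<lambda>x. 1 + (1 + A) * ?q u x + E * ?q u x powr p)"
          using pt bd integrable_r integrable_q_powr[OF l True, of p] p by (intro integral_mono) auto
        also have "\<dots> = 1 + (1 + A) * (l + \<mu> * (l + u)) + E * expectation (\<lambda>x. ?q u x powr p)"
          using integrable_r integrable_q_powr[OF l True, of p] p expectation_q[of l u]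
          by (simp add: prob_space)
        also have "\<dots> \<le> 1 + (1 + A) * (l + \<mu> * (l + u)) + E * (g * u powr p + K * l powr p)"
          using moment_p[OF l True] E0 by (intro add_left_mono mult_left_mono) auto
        also have "(1 + A) * (l + \<mu> * (l + u)) = (1 + A) * (1 + \<mu>) * l + ((1 + A) * \<mu>) * u"
          by (simp add: algebra_simps)
        also have "\<dots> = l * ((1 + \<mu>) / (1 - \<mu>)) + A * u" unfolding A(3) unfolding A(2) by simp
        also have "E * (g * u powr p + K * l powr p) \<le> B * u powr p + E * K * l powr p"
          using mult_right_mono[OF Eg, of "u powr p"] by (simp add: algebra_simps)
        finally have *: "expectation (\<lambda>x. (1 + step l k u (r x)) * f (step l k u (r x)))
            \<le> f u + (l * ((1 + \<mu>) / (1 - \<mu>)) + E * K * l powr p)"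
          using True by (simp add: f_def)
        \<comment> \<open>The increment found so far is additive; \<open>f u \<ge> 1\<close> makes
          it multiplicative.\<close>
        have "0 \<le> l * ((1 + \<mu>) / (1 - \<mu>)) + E * K * l powr p"
          using E0 g l mu_bounds
          by (intro mult_nonneg_nonneg add_nonneg_nonneg divide_nonneg_nonneg) auto
        then have "(l * ((1 + \<mu>) / (1 - \<mu>)) + E * K * l powr p) * 1
            \<le> (l * ((1 + \<mu>) / (1 - \<mu>)) + E * K * l powr p) * f u"
          using f1[of u] by (intro mult_left_mono)
        with * show ?thesis by (simp add: algebra_simps)
      qed
      have f0: "0 \<le> f u" for u using f1[of u] by simp
      show "\<exists>f. f \<in> borel_measurable borel \<and> (\<forall>u\<ge>0. 1 \<le> f u) \<and>
        (\<forall>u\<le>2 * k. 0 \<le> f u \<and> f u \<le> 1 + A * (2 * k) + B * (2 * k) powr p) \<and>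
        (\<forall>u\<le>2 * k. expectation (\<lambda>x. (1 + step l k u (r x)) * f (step l k u (r x)))
          \<le> (1 + l * ((1 + \<mu>) / (1 - \<mu>)) + E * K * l powr p) * f u)"
        using f_meas f1 f0 fD drift by blast
    qed
  qed
qed

text \<open>For small \<open>k\<close> the nonlinear factor keeps \<open>(1 + 2 * k) * \<mu>\<close>
  below 1. Iterated, this shows that the living part of the chain has mean of order
  \<open>l\<close>.\<close>

lemma mean_drift:
  "\<exists>k1>0. \<exists>g\<ge>0. g < 1 \<and> (\<forall>k l u. 0 < k \<longrightarrow> k \<le> k1 \<longrightarrow> 0 < l \<longrightarrow>
     expectation (\<lambda>x. max 0 (step l k u (r x))) \<le> g * max 0 u + 4 * l)"
proof -
  obtain k1 where k1: "0 < k1" "k1 \<le> 1/2"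
    and kg: "\<And>t. 0 < t \<Longrightarrow> t \<le> k1 \<Longrightarrow> (1 + 2 * t) powr 1 * \<mu> < (1 + \<mu>) / 2"
    using ex_small_powr_mult_less_one[OF mu_bounds(2), of 1] by auto
  show ?thesis
  proof (rule exI[of _ k1], rule conjI[OF k1(1)], rule exI[of _ "(1 + \<mu>) / 2"], intro conjI allI impI)
    show "0 \<le> (1 + \<mu>) / 2" "(1 + \<mu>) / 2 < 1" using mu_bounds by auto
    fix k l u :: real assume k: "0 < k" "k \<le> k1" and l: "0 < l"
    then have k12: "k \<le> 1/2" using k1 by simp
    let ?v = "max 0 u"
    have pt: "max 0 (step l k u (r x)) \<le> (1 + 2 * k) * (l + r x * (l + ?v))" for x
    proof (cases rule: step_cases[OF l k(1) k12 r_nonneg[of x], of u, case_names dead alive])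
      case dead
      then show ?thesis using k l q_nonneg[OF l, of ?v x] by auto
    next
      case alive
      then show ?thesis by auto
    qed
    have int: "integrable N (\<lambda>x. max 0 (step l k u (r x)))"
    proof (rule integrable_const_bound[where B = "2 * k"])
      show "AE x in N. norm (max 0 (step l k u (r x))) \<le> 2 * k"
      proof (rule AE_I2)
        fix x
        show "norm (max 0 (step l k u (r x))) \<le> 2 * k"
          using step_cases[OF l k(1) k12 r_nonneg[of x], of u] k by force
      qed
    qed simp
    have "expectation (\<lambda>x. max 0 (step l k u (r x))) \<le> expectation (\<lambda>x. (1 + 2 * k) * (l + r x * (l + ?v)))"
      using pt int integrable_r by (intro integral_mono) auto
    also have "\<dots> = (1 + 2 * k) * (l + \<mu> * (l + ?v))" by (simp add: expectation_q)
    also have "\<dots> = (1 + 2 * k) * \<mu> * ?v + (1 + 2 * k) * ((1 + \<mu>) * l)" by (simp add: algebra_simps)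
    also have "\<dots> \<le> (1 + \<mu>) / 2 * ?v + 2 * (2 * l)"
      using kg[OF k] k k12 l mu_bounds by (intro add_mono mult_right_mono mult_mono) auto
    finally show "expectation (\<lambda>x. max 0 (step l k u (r x))) \<le> (1 + \<mu>) / 2 * ?v + 4 * l" by simp
  qed
qed

end

section \<open>Supersolutions bound the quenched law\<close>

lemma measurable_quenched_law_component [measurable]:
  "(\<lambda>X. X i) \<in> quenched_law \<omega> \<rightarrow>\<^sub>M count_space UNIV"
  unfolding measurable_cong_sets[OF sets_quenched_law refl]
  by (rule measurable_component_singleton) simp

lemma sets_quenched_law_cylinder:
  "{X. (\<forall>i<k. X i = x i) \<and> P (X n)} \<in> sets (quenched_law \<omega>)"
proof -
  have "Measurable.pred (quenched_law \<omega>) (\<lambda>X. (\<forall>i<k. X i = x i) \<and> P (X n))"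
    by measurable
  then show ?thesis by (simp add: pred_def)
qed

text \<open>In probabilistic terms, \<open>h (X k) / (1 - l) ^ k\<close> is a supermartingale for
  \<open>l < 1\<close>. The walk moves at most \<open>k\<close> in \<open>k\<close> steps, so before
  time \<open>n\<close> it is at sites with \<open>\<bar>x\<bar> < n\<close>.\<close>

lemma quenched_law_supersolution:
  fixes \<omega> :: env and h :: "int \<Rightarrow> real" and n :: nat
  assumes \<omega>: "\<And>x. \<omega> x \<in> {0..1}" and l: "l \<le> 1"
    and super: "\<And>x. \<bar>x\<bar> < int n \<Longrightarrow> \<omega> x * h (x + 1) + (1 - \<omega> x) * h (x - 1) \<le> (1 - l) * h x"
    and h_nonneg: "\<And>x. \<bar>x\<bar> \<le> int n \<Longrightarrow> 0 \<le> h x"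
    and h_ge_1: "\<And>x. \<bar>x\<bar> \<le> int n \<Longrightarrow> P x \<Longrightarrow> 1 \<le> h x"
  shows "measure (quenched_law \<omega>) {X. P (X n)} \<le> (1 - l) ^ n * h 0"
proof -
  interpret Q: prob_space "quenched_law \<omega>" by (rule prob_space_quenched_law)
  let ?\<mu> = "measure (quenched_law \<omega>)"
  define S where "S k x = {X :: nat \<Rightarrow> int. \<forall>i<Suc k. X i = x i}" for k and x :: "nat \<Rightarrow> int"
  define T where "T k x = {X :: nat \<Rightarrow> int. (\<forall>i<Suc k. X i = x i) \<and> P (X n)}" for k and x :: "nat \<Rightarrow> int"
  have S_sets [measurable]: "S k x \<in> sets (quenched_law \<omega>)" for k x
    using sets_quenched_law_cylinder[of "Suc k" x "\<lambda>_. True" n \<omega>] by (simp add: S_def)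
  have T_sets [measurable]: "T k x \<in> sets (quenched_law \<omega>)" for k x
    using sets_quenched_law_cylinder[of "Suc k" x P] by (simp add: T_def)
  \<comment> \<open>Induction on the remaining time \<open>m\<close>, with the path fixed up to time
    \<open>k = n - m\<close>; the condition on \<open>x i\<close> keeps the current site where
    \<open>super\<close> applies.\<close>
  have main: "k + m = n \<Longrightarrow> (\<And>i. i \<le> k \<Longrightarrow> \<bar>x i\<bar> \<le> int i) \<Longrightarrow>
      ?\<mu> (T k x) \<le> ?\<mu> (S k x) * ((1 - l) ^ m * h (x k))" for m k x
  proof (induction m arbitrary: k x)
    case 0
    show ?case
    proof (cases "P (x n)")
      case True
      have "?\<mu> (T k x) \<le> ?\<mu> (S k x) * 1"
        unfolding mult_1_right by (rule Q.finite_measure_mono[OF _ S_sets]) (auto simp: T_def S_def)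
      also have "\<dots> \<le> ?\<mu> (S k x) * h (x k)"
        using 0 True by (intro mult_left_mono h_ge_1) auto
      finally show ?thesis by simp
    next
      case False
      then have "T k x = {}" using 0 by (auto simp: T_def)
      then show ?thesis using 0 h_nonneg by simp
    qed
  next
    case (Suc m)
    let ?up = "x(Suc k := x k + 1)" and ?dn = "x(Suc k := x k - 1)"
    let ?w = "\<omega> (x k)"
    have up: "?\<mu> (S (Suc k) ?up) = ?\<mu> (S k x) * ?w"
      using quenched_law_step(1)[of \<omega> ?up k] \<omega> by (simp add: S_def)
    have dn: "?\<mu> (S (Suc k) ?dn) = ?\<mu> (S k x) * (1 - ?w)"
      using quenched_law_step(2)[of \<omega> ?dn k] \<omega> by (simp add: S_def)
    have disj: "S (Suc k) ?up \<inter> S (Suc k) ?dn = {}"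
      by (auto simp: S_def dest!: spec[of _ "Suc k"])
    have sub: "S (Suc k) ?up \<union> S (Suc k) ?dn \<subseteq> S k x"
      by (auto simp: S_def dest: less_SucI split: if_splits)
    have "?\<mu> (S (Suc k) ?up \<union> S (Suc k) ?dn) = ?\<mu> (S (Suc k) ?up) + ?\<mu> (S (Suc k) ?dn)"
      by (intro Q.finite_measure_Union S_sets disj)
    also have "\<dots> = ?\<mu> (S k x)" unfolding up dn by (simp add: algebra_simps)
    \<comment> \<open>Up to a null set the next step goes to a neighbour, so only two continuations
      count.\<close>
    finally have null: "?\<mu> (S k x - (S (Suc k) ?up \<union> S (Suc k) ?dn)) = 0"
      using sub by (subst Q.finite_measure_Diff) auto
    have "T k x \<subseteq> T (Suc k) ?up \<union> T (Suc k) ?dn \<union> (S k x - (S (Suc k) ?up \<union> S (Suc k) ?dn))"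
      by (auto simp: T_def S_def)
    then have "?\<mu> (T k x) \<le> ?\<mu> (T (Suc k) ?up \<union> T (Suc k) ?dn \<union> (S k x - (S (Suc k) ?up \<union> S (Suc k) ?dn)))"
      by (intro Q.finite_measure_mono) auto
    also have "\<dots> \<le> ?\<mu> (T (Suc k) ?up) + ?\<mu> (T (Suc k) ?dn) + ?\<mu> (S k x - (S (Suc k) ?up \<union> S (Suc k) ?dn))"
      by (intro order_trans[OF measure_Un_le] add_mono measure_Un_le) auto
    also have "\<dots> = ?\<mu> (T (Suc k) ?up) + ?\<mu> (T (Suc k) ?dn)" using null by simp
    also have "\<dots> \<le> ?\<mu> (S (Suc k) ?up) * ((1 - l) ^ m * h (x k + 1))
        + ?\<mu> (S (Suc k) ?dn) * ((1 - l) ^ m * h (x k - 1))"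
    proof (rule add_mono)
      have b: "\<bar>x k\<bar> \<le> int k" using Suc.prems(2)[of k] by simp
      have "\<bar>?up i\<bar> \<le> int i" "\<bar>?dn i\<bar> \<le> int i" if "i \<le> Suc k" for i
        using that b Suc.prems(2)[of i] by (auto simp: le_Suc_eq)
      then show "?\<mu> (T (Suc k) ?up) \<le> ?\<mu> (S (Suc k) ?up) * ((1 - l) ^ m * h (x k + 1))"
        "?\<mu> (T (Suc k) ?dn) \<le> ?\<mu> (S (Suc k) ?dn) * ((1 - l) ^ m * h (x k - 1))"
        using Suc.IH[of "Suc k" ?up] Suc.IH[of "Suc k" ?dn] Suc.prems(1)
        by (simp_all only: fun_upd_same add_Suc_right add_Suc)
    qed
    also have "\<dots> = ?\<mu> (S k x) * (1 - l) ^ m * (?w * h (x k + 1) + (1 - ?w) * h (x k - 1))"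
      unfolding up dn by (simp add: algebra_simps)
    also have "\<dots> \<le> ?\<mu> (S k x) * (1 - l) ^ m * ((1 - l) * h (x k))"
      using Suc.prems(1) Suc.prems(2)[of k] l by (intro mult_left_mono super) auto
    finally show ?case by (simp add: mult_ac)
  qed
  have "AE X in quenched_law \<omega>. X \<in> S 0 (\<lambda>_. 0)"
    using quenched_law_start[of \<omega>] Q.prob_eq_1[of "S 0 (\<lambda>_. 0)"] S_sets[of 0 "\<lambda>_. 0"]
    by (simp add: S_def)
  then have "?\<mu> {X. P (X n)} = ?\<mu> (T 0 (\<lambda>_. 0))"
    using sets_quenched_law_cylinder[of 0 "\<lambda>_. 0" P n \<omega>] T_sets[of 0 "\<lambda>_. 0"]
    by (intro Q.finite_measure_eq_AE) (auto simp: S_def T_def)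
  also have "\<dots> \<le> ?\<mu> (S 0 (\<lambda>_. 0)) * ((1 - l) ^ n * h 0)"
    by (rule main) auto
  also have "?\<mu> (S 0 (\<lambda>_. 0)) = 1"
    using quenched_law_start[of \<omega>] by (simp add: S_def)
  finally show ?thesis by simp
qed

text \<open>A real version of \<open>rho\<close>; 0 is a default value outside
  \<open>(0, 1]\<close>, a null set for the site laws considered here.\<close>

definition ratio :: "real \<Rightarrow> real" where
  "ratio t = (if 0 < t \<and> t \<le> 1 then (1 - t) / t else 0)"

lemma ratio_nonneg: "0 \<le> ratio t"
  by (simp add: ratio_def)

lemma measurable_ratio [measurable]: "ratio \<in> borel_measurable borel"
  unfolding ratio_def by measurable

text \<open>The function \<open>h x = (\<Prod>i=x..n. \<phi> i) / (\<Prod>i=N..n. \<phi> i)\<close> exceeds 1 to the left of \<open>N\<close>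
  and decreases past \<open>N\<close>, so one exponential Chebyshev bound covers both late arrival at \<open>N\<close>
  and backtracking from beyond \<open>N\<close>.\<close>

lemma quenched_law_less_le:
  fixes \<omega> :: env and u :: "int \<Rightarrow> real" and n :: nat and N :: int
  assumes \<omega>: "\<And>x. 0 < \<omega> x \<and> \<omega> x \<le> 1" and l: "l \<le> 1" and N: "0 \<le> N" "N \<le> int n"
    and u: "\<And>x. \<bar>x\<bar> \<le> int n \<Longrightarrow> 0 \<le> u x"
    and q: "\<And>x. \<bar>x\<bar> < int n \<Longrightarrow> l + ratio (\<omega> x) * (l + u (x - 1)) < 1"
    and u_eq: "\<And>x. \<bar>x\<bar> < int n \<Longrightarrow>
      u x = (l + ratio (\<omega> x) * (l + u (x - 1))) / (1 - (l + ratio (\<omega> x) * (l + u (x - 1))))"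
  shows "measure (quenched_law \<omega>) {X. X n < N} \<le> (1 - l) ^ n * (\<Prod>i\<in>{0..<N}. 1 + u i)"
proof -
  \<comment> \<open>The maximum with 0 agrees with \<open>1 + u i\<close> on the window and gives
    \<open>p i \<ge> 1\<close> elsewhere, where \<open>u\<close> is arbitrary.\<close>
  define p where "p i = (1::real) + max 0 (u i)" for i :: int
  have p1: "1 \<le> p i" for i by (simp add: p_def)
  then have p0: "0 < p i" for i by (rule less_le_trans[OF zero_less_one])
  define R where "R a b = (\<Prod>i\<in>{a..b}. p i)" for a b
  have R1: "1 \<le> R a b" for a b unfolding R_def using p1 by (intro prod_ge_1) auto
  then have R0: "0 < R a b" for a b by (rule less_le_trans[OF zero_less_one])
  define h where "h x = R x (int n) / R N (int n)" for x
  have h_step: "h x = p x * h (x + 1)" if "x \<le> int n" for x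
  proof -
    have "{x..int n} = insert x {x + 1..int n}" using that by auto
    then show ?thesis by (simp add: h_def R_def)
  qed
  have h0: "0 < h x" for x using R0 by (simp add: h_def)
  have split: "R x (int n) = (\<Prod>i\<in>{x..<N}. p i) * R N (int n)" if "x \<le> N" for x
  proof -
    have "{x..int n} = {x..<N} \<union> {N..int n}" using that N by auto
    then show ?thesis unfolding R_def by (simp, subst prod.union_disjoint) auto
  qed
  have "measure (quenched_law \<omega>) {X. X n < N} \<le> (1 - l) ^ n * h 0"
  proof (rule quenched_law_supersolution[OF _ l])
    show "\<omega> x \<in> {0..1}" for x using \<omega>[of x] by simp
    show "0 \<le> h x" for x using h0[of x] by simp
    show "1 \<le> h x" if "x < N" for x
    proof -
      have "h x = (\<Prod>i\<in>{x..<N}. p i)" using split[of x] that R0[of N "int n"] by (simp add: h_def)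
      also have "1 \<le> \<dots>" using p1 by (intro prod_ge_1) auto
      finally show ?thesis .
    qed
    show "\<omega> x * h (x + 1) + (1 - \<omega> x) * h (x - 1) \<le> (1 - l) * h x" if x: "\<bar>x\<bar> < int n" for x
    proof -
      define w where "w = \<omega> x"
      define Q where "Q = l + ratio w * (l + u (x - 1))"
      have w: "0 < w" "w \<le> 1" using \<omega> by (auto simp: w_def)
      have Q: "Q < 1" "u x = Q / (1 - Q)" using q[OF x] u_eq[OF x] by (auto simp: Q_def w_def)
      have "p x = 1 + u x" "p (x - 1) = 1 + u (x - 1)"
        using u[of x] u[of "x - 1"] x by (auto simp: p_def)
      then have p: "p x * (1 - Q) = 1" "p (x - 1) = 1 + u (x - 1)"
        using Q by (auto simp: field_simps)
      \<comment> \<open>Multiplying \<open>Q\<close> by \<open>w\<close> clears the ratio; with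
        \<open>p (x - 1) = 1 + u (x - 1)\<close> this becomes the supersolution condition, with
        equality.\<close>
      have "w * Q = w * l + (1 - w) * (l + u (x - 1))"
        using w by (simp add: Q_def ratio_def field_simps)
      then have id: "w * (1 - Q) + (1 - w) * p (x - 1) = 1 - l"
        unfolding p(2) by (simp add: algebra_simps)
      have "w * h (x + 1) + (1 - w) * h (x - 1)
          = h (x + 1) * (w * 1 + (1 - w) * (p (x - 1) * p x))"
        using h_step[of x] h_step[of "x - 1"] x by (simp add: algebra_simps)
      also have "\<dots> = h (x + 1) * (w * (p x * (1 - Q)) + (1 - w) * (p (x - 1) * p x))"
        unfolding p(1) ..
      also have "\<dots> = h (x + 1) * p x * (w * (1 - Q) + (1 - w) * p (x - 1))"
        by (simp add: algebra_simps)
      also have "\<dots> = (1 - l) * h x" unfolding id using h_step[of x] x by simp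
      finally show ?thesis by (simp add: w_def)
    qed
  qed
  also have "h 0 = (\<Prod>i\<in>{0..<N}. p i)" using split[of 0] N R0[of N "int n"] by (simp add: h_def)
  also have "\<dots> = (\<Prod>i\<in>{0..<N}. 1 + u i)"
    using N u by (intro prod.cong) (auto simp: p_def)
  finally show ?thesis .
qed

section \<open>Resampling one site of an i.i.d. environment\<close>

locale iid_env = ratio_law N ratio s for N :: "real measure" and s +
  assumes sets_N [measurable_cong]: "sets N = sets borel"
    and support_N: "AE t in N. 0 < t \<and> t \<le> 1"
begin

text \<open>Coordinates range over all reals instead of the unit interval, so replacing one
  coordinate by any real stays in the space.\<close>

definition env_law :: "env measure" where
  "env_law = (\<Pi>\<^sub>M x\<in>UNIV. N)"

lemma space_N: "space N = UNIV"
  using sets_eq_imp_space_eq[OF sets_N] by simp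

lemma sets_env_law [measurable_cong]: "sets env_law = sets (\<Pi>\<^sub>M x\<in>UNIV. N)"
  by (simp add: env_law_def)

lemma space_env_law [simp]: "space env_law = UNIV"
  by (simp add: env_law_def space_PiM space_N)

sublocale E: prob_space env_law
  unfolding env_law_def by (rule prob_space_PiM) (rule prob_space_axioms)

lemma measurable_env_component [measurable]: "(\<lambda>w. w i) \<in> env_law \<rightarrow>\<^sub>M borel"
proof -
  have "(\<lambda>w. w i) \<in> (\<Pi>\<^sub>M x\<in>UNIV. N) \<rightarrow>\<^sub>M N"
    by (rule measurable_component_singleton) simp
  then show ?thesis by (simp add: env_law_def measurable_cong_sets[OF refl sets_N])
qed

lemma AE_env_law: "AE w in env_law. \<forall>x. 0 < w x \<and> w x \<le> 1"
  unfolding env_law_def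
  by (intro AE_all_countable[THEN iffD2] allI AE_PiM_component[where P = "\<lambda>t. 0 < t \<and> t \<le> 1"])
    (simp_all only: UNIV_I support_N prob_space_axioms)

lemma distr_resample: "distr (N \<Otimes>\<^sub>M env_law) env_law (\<lambda>(t, w). w(i := t)) = env_law"
  using distr_pair_PiM_eq_PiM[of UNIV "\<lambda>_. N" i] prob_space_axioms
  by (simp add: env_law_def)

lemma measurable_resample [measurable]: "(\<lambda>(t, w). w(i := t)) \<in> N \<Otimes>\<^sub>M env_law \<rightarrow>\<^sub>M env_law"
proof -
  have "(\<lambda>z. (snd z)(i := fst z)) \<in> N \<Otimes>\<^sub>M (\<Pi>\<^sub>M x\<in>UNIV. N) \<rightarrow>\<^sub>M (\<Pi>\<^sub>M x\<in>UNIV. N)"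
  proof (rule measurable_PiM_single')
    fix j
    show "(\<lambda>z. ((snd z)(i := fst z)) j) \<in> N \<Otimes>\<^sub>M (\<Pi>\<^sub>M x\<in>UNIV. N) \<rightarrow>\<^sub>M N"
      by (cases "j = i") auto
  qed (auto simp: space_PiM space_pair_measure space_N)
  then show ?thesis by (simp add: env_law_def case_prod_beta')
qed

context
  fixes \<Psi> :: "env \<Rightarrow> real" and B :: real and i :: int
  assumes \<Psi>_measurable [measurable]: "\<Psi> \<in> borel_measurable env_law"
    and \<Psi>_bound: "\<And>w. \<bar>\<Psi> w\<bar> \<le> B"
begin

lemma integrable_pair_resample: "integrable (N \<Otimes>\<^sub>M env_law) (\<lambda>(t, w). \<Psi> (w(i := t)))"
proof -
  interpret P: pair_prob_space N env_law ..
  show ?thesis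
  proof (rule P.integrable_const_bound[where B = B])
    have "(\<lambda>z. \<Psi> ((\<lambda>(t, w). w(i := t)) z)) \<in> borel_measurable (N \<Otimes>\<^sub>M env_law)"
      by measurable
    then show "(\<lambda>(t, w). \<Psi> (w(i := t))) \<in> borel_measurable (N \<Otimes>\<^sub>M env_law)"
      by (simp add: case_prod_beta')
  qed (use \<Psi>_bound in auto)
qed

lemma integrable_resample: "integrable env_law (\<lambda>w. expectation (\<lambda>t. \<Psi> (w(i := t))))"
proof -
  interpret P: pair_prob_space N env_law ..
  show ?thesis by (rule P.integrable_snd[OF integrable_pair_resample])
qed

text \<open>Resampling coordinate \<open>i\<close> preserves the product law, so Fubini's theorem
  averages out that coordinate first. This takes the place of conditional expectations in the
  one-step estimates.\<close>

lemma integral_resample: "E.expectation (\<lambda>w. expectation (\<lambda>t. \<Psi> (w(i := t)))) = E.expectation \<Psi>"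
proof -
  interpret P: pair_prob_space N env_law ..
  have "E.expectation \<Psi> = integral\<^sup>L (distr (N \<Otimes>\<^sub>M env_law) env_law (\<lambda>(t, w). w(i := t))) \<Psi>"
    by (simp only: distr_resample)
  also have "\<dots> = integral\<^sup>L (N \<Otimes>\<^sub>M env_law) (\<lambda>z. \<Psi> ((\<lambda>(t, w). w(i := t)) z))"
    by (rule integral_distr) measurable
  also have "\<dots> = integral\<^sup>L (N \<Otimes>\<^sub>M env_law) (\<lambda>(t, w). \<Psi> (w(i := t)))"
    by (simp add: case_prod_beta')
  also have "\<dots> = E.expectation (\<lambda>w. expectation (\<lambda>t. \<Psi> (w(i := t))))"
    by (rule P.integral_snd[OF integrable_pair_resample, symmetric])
  finally show ?thesis ..
qed

lemma integral_resample_ge: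
  assumes "integrable env_law \<Phi>" "\<And>w. \<Phi> w \<le> expectation (\<lambda>t. \<Psi> (w(i := t)))"
  shows "E.expectation \<Phi> \<le> E.expectation \<Psi>"
  unfolding integral_resample[symmetric]
  by (intro integral_mono integrable_resample assms)

lemma integral_resample_le:
  assumes "integrable env_law \<Phi>" "\<And>w. expectation (\<lambda>t. \<Psi> (w(i := t))) \<le> \<Phi> w"
  shows "E.expectation \<Psi> \<le> E.expectation \<Phi>"
  unfolding integral_resample[symmetric]
  by (intro integral_mono integrable_resample assms)

end

section \<open>Approximation by finite windows and a zero-one law\<close>

text \<open>Invariance is demanded under changes of one outside coordinate at a time, the form that
  resampling uses. Tail events satisfy it for every \<open>K\<close>.\<close>

definition cylinders :: "nat \<Rightarrow> env set set" where
  "cylinders K = {A \<in> sets env_law. \<forall>i w t. int K < \<bar>i\<bar> \<longrightarrow> (w(i := t) \<in> A) = (w \<in> A)}"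

lemma cylinders_mono: "K \<le> L \<Longrightarrow> cylinders K \<subseteq> cylinders L"
  by (auto simp: cylinders_def)

lemma cylinders_UN:
  assumes "finite I" "\<And>i. i \<in> I \<Longrightarrow> A i \<in> cylinders (K i)"
  shows "\<exists>L. (\<Union>i\<in>I. A i) \<in> cylinders L"
proof -
  obtain L where L: "\<And>i. i \<in> I \<Longrightarrow> K i \<le> L"
    using assms(1) by (meson finite_imageI Max_ge imageI)
  have "A i \<in> cylinders L" if "i \<in> I" for i
    using cylinders_mono[OF L[OF that]] assms(2)[OF that] by auto
  then have "(\<Union>i\<in>I. A i) \<in> cylinders L"
    using assms(1) by (auto simp: cylinders_def)
  then show ?thesis ..
qed

text \<open>The approximable sets form a sigma-algebra containing the one-coordinate events. A
  countable union is first cut to \<open>m\<close> sets at cost \<open>e / 2\<close>; the rest of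
  the error is shared among these.\<close>

lemma cylinders_approx:
  assumes "D \<in> sets env_law"
  shows "\<forall>e>0. \<exists>K. \<exists>A\<in>cylinders K. E.prob ((A - D) \<union> (D - A)) < e"
proof -
  define R where "R = {{w :: env. w i \<in> B} | i B. B \<in> sets N}"
  have sets_eq: "sets env_law = sigma_sets UNIV R"
    unfolding env_law_def sets_PiM_single R_def by (simp add: space_N)
  have "D \<in> sigma_sets UNIV R" using assms by (simp add: sets_eq)
  then show ?thesis
  proof induction
    case (Basic a)
    then obtain i B where a: "a = {w. w i \<in> B}" by (auto simp: R_def)
    have "a \<in> sets env_law" using Basic by (simp add: sets_eq sigma_sets.Basic)
    then have "a \<in> cylinders (nat \<bar>i\<bar>)" by (auto simp: cylinders_def a)
    then show ?case by (intro allI impI exI bexI[of _ a]) auto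
  next
    case Empty
    have "{} \<in> cylinders 0" by (simp add: cylinders_def)
    then show ?case by (intro allI impI exI bexI[of _ "{}"]) auto
  next
    case (Compl a)
    show ?case
    proof (intro allI impI)
      fix e :: real assume "0 < e"
      then obtain K A where A: "A \<in> cylinders K" "E.prob ((A - a) \<union> (a - A)) < e"
        using Compl.IH by blast
      have "UNIV - A \<in> cylinders K"
        using A(1) sets.compl_sets[of A env_law] by (auto simp: cylinders_def)
      moreover have "((UNIV - A) - (UNIV - a)) \<union> ((UNIV - a) - (UNIV - A)) = (A - a) \<union> (a - A)"
        by auto
      ultimately show "\<exists>K. \<exists>A\<in>cylinders K. E.prob ((A - (UNIV - a)) \<union> ((UNIV - a) - A)) < e"
        using A(2) by metis
    qed
  next
    case (Union a)
    have a_sets [measurable]: "a i \<in> sets env_law" for i using Union(1) by (simp add: sets_eq)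
    show ?case
    proof (intro allI impI)
      fix e :: real assume e: "0 < e"
      have "(\<lambda>m. E.prob (\<Union>i<m. a i)) \<longlonglongrightarrow> E.prob (\<Union>m. \<Union>i<m. a i)"
      proof (rule E.finite_Lim_measure_incseq)
        show "incseq (\<lambda>m. \<Union>i<m. a i)" unfolding incseq_def by (intro allI impI UN_mono) auto
      qed auto
      also have "(\<Union>m. \<Union>i<m. a i) = (\<Union>i. a i)" by auto
      finally have "\<forall>\<^sub>F m in sequentially. E.prob (\<Union>i. a i) - e / 2 < E.prob (\<Union>i<m. a i)"
        by (rule order_tendstoD) (use e in simp)
      then obtain m where m: "E.prob (\<Union>i. a i) - e / 2 < E.prob (\<Union>i<m. a i)"
        by (auto simp: eventually_sequentially)
      have "\<forall>i. \<exists>A. (\<exists>K. A \<in> cylinders K) \<and> E.prob ((A - a i) \<union> (a i - A)) < e / (2 * real (Suc m))"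
        using Union.IH e by (metis divide_pos_pos mult_pos_pos of_nat_0_less_iff zero_less_Suc zero_less_numeral)
      then obtain A where A: "\<And>i. \<exists>K. A i \<in> cylinders K"
        "\<And>i. E.prob ((A i - a i) \<union> (a i - A i)) < e / (2 * real (Suc m))"
        by metis
      then obtain K where K: "\<And>i. A i \<in> cylinders (K i)" by metis
      then have A_sets [measurable]: "A i \<in> sets env_law" for i by (auto simp: cylinders_def)
      obtain L where L: "(\<Union>i<m. A i) \<in> cylinders L"
        using cylinders_UN[of "{..<m}" A K] K by auto
      let ?D = "\<lambda>i. (A i - a i) \<union> (a i - A i)"
      have "E.prob (((\<Union>i<m. A i) - (\<Union>i. a i)) \<union> ((\<Union>i. a i) - (\<Union>i<m. A i)))
          \<le> E.prob ((\<Union>i<m. ?D i) \<union> ((\<Union>i. a i) - (\<Union>i<m. a i)))"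
        by (intro E.finite_measure_mono) auto
      also have "\<dots> \<le> E.prob (\<Union>i<m. ?D i) + E.prob ((\<Union>i. a i) - (\<Union>i<m. a i))"
        by (intro measure_Un_le) auto
      also have "E.prob ((\<Union>i. a i) - (\<Union>i<m. a i)) = E.prob (\<Union>i. a i) - E.prob (\<Union>i<m. a i)"
        by (intro E.finite_measure_Diff) auto
      also have "E.prob (\<Union>i<m. ?D i) \<le> (\<Sum>i<m. E.prob (?D i))"
        by (intro E.finite_measure_subadditive_finite) auto
      also have "\<dots> \<le> (\<Sum>i<m. e / (2 * real (Suc m)))"
        using A(2) by (intro sum_mono) (auto intro: less_imp_le)
      also have "\<dots> \<le> e / 2" using e by (simp add: field_simps)
      finally have "E.prob (((\<Union>i<m. A i) - (\<Union>i. a i)) \<union> ((\<Union>i. a i) - (\<Union>i<m. A i))) < e"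
        using m by linarith
      with L show "\<exists>K. \<exists>A\<in>cylinders K. E.prob ((A - (\<Union>i. a i)) \<union> ((\<Union>i. a i) - A)) < e"
        by blast
    qed
  qed
qed

text \<open>A zero-one law: the event that \<open>G n\<close> occurs infinitely often has conditional probability at
  least \<open>d\<close> given any finite window of the environment.\<close>

lemma AE_frequently_cylinders:
  assumes G [measurable]: "\<And>n. G n \<in> sets env_law" and d: "0 < d"
    and mix: "\<And>K A. A \<in> cylinders K \<Longrightarrow>
      \<exists>e. e \<longlonglongrightarrow> 0 \<and> (\<forall>\<^sub>F n in sequentially. d * E.prob A - e n \<le> E.prob (A \<inter> G n))"
  shows "AE w in env_law. \<exists>\<^sub>F n in sequentially. w \<in> G n"
proof -
  have zero: "E.prob (\<Inter>n\<in>{m..}. - G n) = 0" for m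
  proof (rule ccontr)
    let ?D = "\<Inter>n\<in>{m..}. - G n"
    have D [measurable]: "?D \<in> sets env_law"
    proof -
      have "- G n \<in> sets env_law" for n
        using sets.compl_sets[OF G[of n]] by (simp add: Compl_eq_Diff_UNIV)
      then show ?thesis 
      using sets.top[of env_law] by (intro sets.countable_INT'') auto
    qed
    assume "E.prob ?D \<noteq> 0"
    then have p: "0 < E.prob ?D" by (simp add: zero_less_measure_iff)
    \<comment> \<open>For \<open>n \<ge> m\<close> the set \<open>G n\<close> misses
      \<open>?D\<close>, so an \<open>A\<close> whose symmetric difference from \<open>?D\<close>
      has probability \<open>h' < h\<close> satisfies \<open>E.prob A \<le> h' / d\<close> in the
      limit. Then \<open>E.prob ?D \<le> h' * (1 + 1 / d)\<close>, and \<open>h\<close> is chosen so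
      that this is less than \<open>E.prob ?D\<close>.\<close>
    define h where "h = E.prob ?D / (1 + 1 / d)"
    have "0 < 1 + 1 / d" using d by (simp add: add_pos_pos)
    then have h: "0 < h" "h * (1 + 1 / d) = E.prob ?D" using p by (auto simp: h_def)
    obtain K A where A: "A \<in> cylinders K" "E.prob ((A - ?D) \<union> (?D - A)) < h"
      using cylinders_approx[OF D] h by blast
    then have A_sets [measurable]: "A \<in> sets env_law" by (auto simp: cylinders_def)
    obtain e where e: "e \<longlonglongrightarrow> 0" "\<forall>\<^sub>F n in sequentially. d * E.prob A - e n \<le> E.prob (A \<inter> G n)"
      using mix[OF A(1)] by blast
    define h' where "h' = E.prob ((A - ?D) \<union> (?D - A))"
    have "\<forall>\<^sub>F n in sequentially. d * E.prob A - e n \<le> h'"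
      using e(2) eventually_ge_at_top[of m]
    proof eventually_elim
      case (elim n)
      have "E.prob (A \<inter> G n) \<le> h'"
        unfolding h'_def using elim by (intro E.finite_measure_mono) auto
      with elim show ?case by simp
    qed
    moreover have "(\<lambda>n. d * E.prob A - e n) \<longlonglongrightarrow> d * E.prob A - 0"
      by (intro tendsto_intros e)
    ultimately have "d * E.prob A - 0 \<le> h'"
      by (intro tendsto_upperbound) auto
    then have "E.prob A \<le> h' / d" using d by (simp add: field_simps)
    moreover have "E.prob ?D \<le> E.prob A + h'"
    proof -
      have "E.prob ?D \<le> E.prob (A \<union> ((A - ?D) \<union> (?D - A)))"
        by (intro E.finite_measure_mono) auto
      also have "\<dots> \<le> E.prob A + h'" unfolding h'_def by (intro measure_Un_le) auto
      finally show ?thesis .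
    qed
    ultimately have "E.prob ?D \<le> h' * (1 + 1 / d)" by (simp add: algebra_simps)
    also have "\<dots> < h * (1 + 1 / d)"
      using A(2) \<open>0 < 1 + 1 / d\<close> by (intro mult_strict_right_mono) (auto simp: h'_def)
    finally show False using h by simp
  qed
  have "AE w in env_law. w \<notin> (\<Inter>n\<in>{m..}. - G n)" for m
  proof -
    have "- G n \<in> sets env_law" for n
      using sets.compl_sets[OF G[of n]] by (simp add: Compl_eq_Diff_UNIV)
    then have "(\<Inter>n\<in>{m..}. - G n) \<in> sets env_law" 
      using sets.top[of env_law] by (intro sets.countable_INT'') auto
    then have "(\<Inter>n\<in>{m..}. - G n) \<in> null_sets env_law"
      using zero[of m] by (simp add: null_sets_def E.emeasure_eq_measure)
    then show ?thesis by (rule AE_not_in)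
  qed
  then have "AE w in env_law. \<forall>m. w \<notin> (\<Inter>n\<in>{m..}. - G n)"
    by (simp add: AE_all_countable)
  then show ?thesis
    by eventually_elim (auto simp: frequently_sequentially)
qed

end

section \<open>The recursion along an environment\<close>

text \<open>State \<open>j\<close> belongs to the site \<open>a + j\<close>; the starting site
  \<open>a\<close> carries the value 0 and its ratio is not read.\<close>

primrec chain :: "real \<Rightarrow> real \<Rightarrow> int \<Rightarrow> env \<Rightarrow> nat \<Rightarrow> real" where
  "chain l k a w 0 = 0"
| "chain l k a w (Suc j) = step l k (chain l k a w j) (ratio (w (a + int (Suc j))))"

lemma chain_upd: "a + int j < i \<Longrightarrow> chain l k a (w(i := t)) j = chain l k a w j"
  by (induction j) auto

lemma chain_Suc_upd:
  "chain l k a (w(a + int (Suc j) := t)) (Suc j) = step l k (chain l k a w j) (ratio t)"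
  using chain_upd[of a j "a + int (Suc j)" l k w t] by simp

lemma step_bounds:
  assumes "0 < l" "0 < k" "k \<le> 1/2" "0 \<le> r"
  shows "- 1 \<le> step l k u r" "step l k u r \<le> 2 * k"
  using step_cases[OF assms, of u] assms by force+

lemma chain_bounds:
  assumes "0 < l" "0 < k" "k \<le> 1/2"
  shows "- 1 \<le> chain l k a w j" "chain l k a w j \<le> 2 * k"
  using step_bounds[OF assms ratio_nonneg] assms by (cases j; simp)+

lemma chain_alive_mono:
  assumes "0 \<le> chain l k a w n" "j \<le> n"
  shows "0 \<le> chain l k a w j"
  using assms(2,1)
proof (induction rule: dec_induct)
  case (step n)
  then show ?case by (auto simp: step_def split: if_splits)
qed

lemma chain_alive_Suc:
  assumes "0 \<le> chain l k a w (Suc j)"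
  defines "q \<equiv> l + ratio (w (a + int (Suc j))) * (l + chain l k a w j)"
  shows "q \<le> k" "chain l k a w (Suc j) = q / (1 - q)"
  using assms by (auto simp: step_def Let_def q_def split: if_splits)

text \<open>A killed chain stays killed, so survival for \<open>2 * n\<close> steps from
  \<open>-n\<close> gives nonnegative \<open>u x\<close> on all of \<open>[-n, n]\<close>.\<close>

lemma quenched_law_chain_le:
  assumes w: "\<And>x. 0 < w x \<and> w x \<le> 1" and l: "0 < l" "l \<le> 1" and k: "k < 1" and N: "N \<le> n"
    and alive: "0 \<le> chain l k (- int n) w (2 * n)"
    and M: "(\<Prod>i<N. 1 + chain l k (- int n) w (n + i)) \<le> M"
  shows "measure (quenched_law w) {X. X n < int N} \<le> (1 - l) ^ n * M"
proof -
  define u where "u x = chain l k (- int n) w (nat (x + int n))" for x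
  have u0: "0 \<le> u x" if "\<bar>x\<bar> \<le> int n" for x
    unfolding u_def using that by (intro chain_alive_mono[OF alive]) auto
  have rel: "l + ratio (w x) * (l + u (x - 1)) \<le> k \<and>
      u x = (l + ratio (w x) * (l + u (x - 1))) / (1 - (l + ratio (w x) * (l + u (x - 1))))"
    if x: "\<bar>x\<bar> < int n" for x
  proof -
    have 1: "nat (x + int n) = Suc (nat (x - 1 + int n))" using x by auto
    have 2: "- int n + int (Suc (nat (x - 1 + int n))) = x" using x by auto
    have "0 \<le> chain l k (- int n) w (Suc (nat (x - 1 + int n)))"
      using u0[of x] x by (simp add: u_def 1)
    from chain_alive_Suc[OF this] show ?thesis unfolding u_def 1 2 by blast
  qed
  have "measure (quenched_law w) {X. X n < int N} \<le> (1 - l) ^ n * (\<Prod>i\<in>{0..<int N}. 1 + u i)"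
    using rel k u0 N l by (intro quenched_law_less_le w) (auto intro: le_less_trans)
  also have "(\<Prod>i\<in>{0..<int N}. 1 + u i) = (\<Prod>i<N. 1 + chain l k (- int n) w (n + i))"
    unfolding u_def
    by (rule prod.reindex_bij_witness[where i = int and j = nat]) (auto simp: nat_add_distrib add.commute)
  also have "(1 - l) ^ n * \<dots> \<le> (1 - l) ^ n * M"
    using M l by (intro mult_left_mono) auto
  finally show ?thesis .
qed

section \<open>Mean, survival and passage products of the chain in a random environment\<close>

context iid_env
begin

lemma prob_env_law_UNIV: "E.prob UNIV = 1"
  using E.prob_space by simp

lemma measurable_chain [measurable]: "(\<lambda>w. chain l k a w j) \<in> borel_measurable env_law"
  by (induction j) auto

text \<open>The bound is the fixed point of \<open>e = g * e + 4 * l\<close>, and the chain starts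
  at 0.\<close>

lemma expectation_chain_le:
  assumes l: "0 < l" and k: "0 < k" "k \<le> 1/2" and g: "0 \<le> g" "g < 1"
    and drift: "\<And>u. expectation (\<lambda>t. max 0 (step l k u (ratio t))) \<le> g * max 0 u + 4 * l"
  shows "E.expectation (\<lambda>w. max 0 (chain l k a w j)) \<le> 4 * l / (1 - g)"
proof (induction j)
  case 0
  then show ?case using l g by simp
next
  case (Suc j)
  let ?U = "\<lambda>w. chain l k a w j"
  have bd: "\<bar>max 0 (chain l k a w j)\<bar> \<le> 2 * k" for w j
    using chain_bounds[OF l k, of a w j] k by auto
  have int: "integrable env_law (\<lambda>w. max 0 (?U w))"
    using bd by (intro E.integrable_const_bound[where B = "2 * k"]) auto
  have "E.expectation (\<lambda>w. max 0 (chain l k a w (Suc j)))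
      \<le> E.expectation (\<lambda>w. g * max 0 (?U w) + 4 * l)"
  proof (rule integral_resample_le[where B = "2 * k" and i = "a + int (Suc j)"])
    show "expectation (\<lambda>t. max 0 (chain l k a (w(a + int (Suc j) := t)) (Suc j)))
        \<le> g * max 0 (?U w) + 4 * l" for w
      unfolding chain_Suc_upd by (rule drift)
  qed (use bd[of _ "Suc j"] int in \<open>auto simp del: chain.simps\<close>)
  also have "\<dots> = g * E.expectation (\<lambda>w. max 0 (?U w)) + 4 * l"
    using int by (simp add: prob_env_law_UNIV)
  also have "\<dots> \<le> g * (4 * l / (1 - g)) + 4 * l"
    using Suc g by (intro add_right_mono mult_left_mono) auto
  also have "\<dots> = 4 * l / (1 - g)" using g by (simp add: field_simps)
  finally show ?case .
qed

text \<open>A site outside the window of \<open>A\<close> is independent of \<open>A\<close> and of the past of the chain, so its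
  step costs the factor \<open>1 - C * l powr s\<close>; each of the at most \<open>2 * K + 1\<close> sites of the window
  costs an additive error of order \<open>l\<close>.\<close>

lemma survival_chain:
  assumes l: "0 < l" and k: "0 < k" "k \<le> 1/2" and g: "0 \<le> g" "g < 1"
    and drift: "\<And>u. expectation (\<lambda>t. max 0 (step l k u (ratio t))) \<le> g * max 0 u + 4 * l"
    and H: "survival_fun C l k H" and C: "0 \<le> C" "C * l powr s \<le> 1" and A: "A \<in> cylinders K"
  shows "(1 - C * l powr s) ^ j * E.prob A - (2 * real K + 1) * (C * (l + 4 * l / (1 - g)))
    \<le> E.expectation (\<lambda>w. indicator A w * H (chain l k a w j))"
proof -
  define d where "d = C * (l + 4 * l / (1 - g))"
  define c where "c = 1 - C * l powr s"
  \<comment> \<open>The sites of the window met by step \<open>j\<close>; each is charged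
    \<open>d\<close> once.\<close>
  define mid where "mid j = {- int K..int K} \<inter> {a<..a + int j}" for j
  let ?U = "chain l k a"
  let ?E = "\<lambda>j. E.expectation (\<lambda>w. indicator A w * H (?U w j))"
  have c: "0 \<le> c" "c \<le> 1" using C by (auto simp: c_def)
  have d: "0 \<le> d" using C l g by (simp add: d_def)
  have [measurable]: "H \<in> borel_measurable borel" and H0: "H 0 = 1"
    and Hneg: "\<And>u. u < 0 \<Longrightarrow> H u = 0" and H01: "\<And>u. 0 \<le> H u" "\<And>u. H u \<le> 1"
    and H_drift: "\<And>u. u \<le> 2 * k \<Longrightarrow> c * H u \<le> expectation (\<lambda>t. H (step l k u (ratio t)))"
    and H_loss: "\<And>u. 0 \<le> u \<Longrightarrow> u \<le> 2 * k \<Longrightarrow> expectation (\<lambda>t. 1 - H (step l k u (ratio t))) \<le> C * (l + u)"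
    using H by (auto simp: survival_fun_def c_def)
  have [measurable]: "A \<in> sets env_law" using A by (simp add: cylinders_def)
  have A_upd: "w(i := t) \<in> A \<longleftrightarrow> w \<in> A" if "int K < \<bar>i\<bar>" for w i t
    using A that by (simp add: cylinders_def)
  have bd: "\<bar>indicator A w * H (?U w j)\<bar> \<le> 1" for w j
    using H01[of "?U w j"] by (auto simp: indicator_def)
  have int: "integrable env_law (\<lambda>w. indicator A w * H (?U w j))" for j
    using bd by (intro E.integrable_const_bound[where B = 1]) auto
  have fresh: "c * ?E j \<le> ?E (Suc j)" if i: "int K < \<bar>a + int (Suc j)\<bar>" for j
  proof -
    have "E.expectation (\<lambda>w. c * (indicator A w * H (?U w j))) \<le> ?E (Suc j)"
    proof (rule integral_resample_ge[where B = 1 and i = "a + int (Suc j)"])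
      fix w
      have "indicator A (w(a + int (Suc j) := t)) = (indicator A w :: real)" for t
        using A_upd[OF i, of w t] by (simp add: indicator_def)
      then show "c * (indicator A w * H (?U w j)) \<le> expectation (\<lambda>t.
          indicator A (w(a + int (Suc j) := t)) * H (?U (w(a + int (Suc j) := t)) (Suc j)))"
        unfolding chain_Suc_upd
        using H_drift[OF chain_bounds(2)[OF l k, of a w j]] by (simp add: indicator_def)
    qed (use bd int in \<open>auto simp del: chain.simps\<close>)
    then show ?thesis by simp
  qed
  \<comment> \<open>When \<open>A\<close> may depend on the site, its indicator cannot be taken out
    of the average. It is bounded by 1, and the loss is counted over all environments in which the
    chain is alive.\<close>
  have old: "?E j - d \<le> ?E (Suc j)" for j
  proof -
    have int': "integrable env_law (\<lambda>w. indicator {w. 0 \<le> ?U w j} w * (1 - H (?U w (Suc j))))"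
      using H01[of "?U _ (Suc j)"]
      by (intro E.integrable_const_bound[where B = 1]) (auto simp: indicator_def simp del: chain.simps)
    have intU: "integrable env_law (\<lambda>w. max 0 (?U w j))"
      using chain_bounds[OF l k, of a _ j] k
      by (intro E.integrable_const_bound[where B = "2 * k"]) auto
    have "?E j - ?E (Suc j)
        = E.expectation (\<lambda>w. indicator A w * H (?U w j) - indicator A w * H (?U w (Suc j)))"
      using int[of j] int[of "Suc j"] by (simp del: chain.simps)
    also have "\<dots> \<le> E.expectation (\<lambda>w. indicator {w. 0 \<le> ?U w j} w * (1 - H (?U w (Suc j))))"
    proof (intro integral_mono int' Bochner_Integration.integrable_diff int)
      fix w
      show "indicator A w * H (?U w j) - indicator A w * H (?U w (Suc j))
          \<le> indicator {w. 0 \<le> ?U w j} w * (1 - H (?U w (Suc j)))"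
        using H01[of "?U w j"] H01[of "?U w (Suc j)"] Hneg[of "?U w j"]
        by (auto simp: indicator_def not_le simp del: chain.simps)
    qed
    also have "\<dots> \<le> E.expectation (\<lambda>w. C * (l + max 0 (?U w j)))"
    proof (rule integral_resample_le[where B = 1 and i = "a + int (Suc j)"])
      fix w
      have "0 \<le> C * (l + max 0 (?U w j))" using C l by (intro mult_nonneg_nonneg) auto
      moreover have "indicator {w. 0 \<le> ?U w j} (w(a + int (Suc j) := t))
          = (indicator {w. 0 \<le> ?U w j} w :: real)" for t
        by (simp add: indicator_def chain_upd)
      ultimately show "expectation (\<lambda>t. indicator {w. 0 \<le> ?U w j} (w(a + int (Suc j) := t))
          * (1 - H (?U (w(a + int (Suc j) := t)) (Suc j)))) \<le> C * (l + max 0 (?U w j))"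
        unfolding chain_Suc_upd
        using H_loss[OF _ chain_bounds(2)[OF l k, of a w j]] by (auto simp: indicator_def)
    qed (use intU H01[of "?U _ (Suc j)"] in \<open>auto simp: indicator_def simp del: chain.simps\<close>)
    also have "\<dots> = C * (l + E.expectation (\<lambda>w. max 0 (?U w j)))"
      using intU by (simp add: prob_env_law_UNIV)
    also have "\<dots> \<le> d"
      unfolding d_def using expectation_chain_le[OF l k g drift] C
      by (intro mult_left_mono add_left_mono) auto
    finally show ?thesis by simp
  qed
  have "c ^ j * E.prob A - real (card (mid j)) * d \<le> ?E j"
  proof (induction j)
    case 0
    then show ?case by (simp add: mid_def H0)
  next
    case (Suc j)
    let ?i = "a + int (Suc j)"
    have p: "0 \<le> c ^ j * E.prob A" using c by simp
    have cd: "0 \<le> real (card (mid j)) * d" using d by simp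
    show ?case
    proof (cases "int K < \<bar>?i\<bar>")
      case True
      then have "mid (Suc j) = mid j" by (auto simp: mid_def)
      then have "c ^ Suc j * E.prob A - real (card (mid (Suc j))) * d
          \<le> c * (c ^ j * E.prob A - real (card (mid j)) * d)"
        using mult_right_mono[OF c(2) cd] by (simp add: algebra_simps)
      also have "\<dots> \<le> c * ?E j" using Suc c by (intro mult_left_mono)
      also have "\<dots> \<le> ?E (Suc j)" using fresh[OF True] .
      finally show ?thesis .
    next
      case False
      then have "mid (Suc j) = insert ?i (mid j)" "?i \<notin> mid j" "finite (mid j)"
        by (auto simp: mid_def)
      then have "real (card (mid (Suc j))) = real (card (mid j)) + 1" by simp
      then have "c ^ Suc j * E.prob A - real (card (mid (Suc j))) * d
          \<le> (c ^ j * E.prob A - real (card (mid j)) * d) - d"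
        using mult_right_mono[OF c(2) p] by (simp add: algebra_simps)
      then show ?thesis using Suc old[of j] by linarith
    qed
  qed
  moreover have "real (card (mid j)) * d \<le> (2 * real K + 1) * d"
  proof (rule mult_right_mono[OF _ d])
    have "card (mid j) \<le> card {- int K..int K}" unfolding mid_def by (intro card_mono) auto
    then show "real (card (mid j)) \<le> 2 * real K + 1" by simp
  qed
  ultimately show ?thesis unfolding c_def d_def by linarith
qed

text \<open>Resampling the newest site leaves the earlier factors unchanged, so each step multiplies
  the mean by at most \<open>c\<close>. The bound \<open>f \<le> D\<close> covers the unknown state
  at time \<open>m\<close>.\<close>

lemma passage_chain:
  assumes l: "0 < l" and k: "0 < k" "k \<le> 1/2" and c: "0 \<le> c"
    and [measurable]: "f \<in> borel_measurable borel"
    and f: "\<And>u. u \<le> 2 * k \<Longrightarrow> 0 \<le> f u \<and> f u \<le> D"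
    and drift: "\<And>u. u \<le> 2 * k \<Longrightarrow>
      expectation (\<lambda>t. (1 + step l k u (ratio t)) * f (step l k u (ratio t))) \<le> c * f u"
  shows "integrable env_law (\<lambda>w. (\<Prod>i<j. 1 + chain l k a w (m + Suc i)) * f (chain l k a w (m + j)))"
    and "E.expectation (\<lambda>w. (\<Prod>i<j. 1 + chain l k a w (m + Suc i)) * f (chain l k a w (m + j))) \<le> c ^ j * D"
proof -
  let ?U = "chain l k a"
  let ?Z = "\<lambda>j w. (\<Prod>i<j. 1 + ?U w (m + Suc i)) * f (?U w (m + j))"
  have u: "0 \<le> 1 + ?U w i" "1 + ?U w i \<le> 1 + 2 * k" "0 \<le> f (?U w i)" "f (?U w i) \<le> D" for w i
    using chain_bounds[OF l k, of a w i] f[of "?U w i"] by auto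
  have P0: "0 \<le> (\<Prod>i<j. 1 + ?U w (m + Suc i))" for j w
    using u by (intro prod_nonneg) blast
  have bd: "\<bar>?Z j w\<bar> \<le> (1 + 2 * k) ^ j * D" for j w
  proof -
    have "(\<Prod>i<j. 1 + ?U w (m + Suc i)) \<le> (\<Prod>i<j. 1 + 2 * k)"
      using u by (intro prod_mono) blast
    then have "?Z j w \<le> (1 + 2 * k) ^ j * D"
      using u[of w "m + j"] P0[of w j] k by (intro mult_mono) auto
    moreover have "0 \<le> ?Z j w" using u[of w "m + j"] P0[of w j] by (intro mult_nonneg_nonneg) auto
    ultimately show ?thesis by simp
  qed
  show int: "integrable env_law (?Z j)" for j
    using bd by (intro E.integrable_const_bound[where B = "(1 + 2 * k) ^ j * D"]) auto
  show "E.expectation (?Z j) \<le> c ^ j * D"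
  proof (induction j)
    case 0
    have "E.expectation (?Z 0) \<le> E.expectation (\<lambda>w. D)"
      using int[of 0] u(4) by (intro integral_mono) auto
    then show ?case by (simp add: prob_env_law_UNIV)
  next
    case (Suc j)
    have "E.expectation (?Z (Suc j)) \<le> E.expectation (\<lambda>w. c * ?Z j w)"
    proof (rule integral_resample_le[where B = "(1 + 2 * k) ^ Suc j * D" and i = "a + int (Suc (m + j))"])
      fix w
      let ?w = "\<lambda>t::real. w(a + int (Suc (m + j)) := t)"
      have "(\<Prod>i<j. 1 + ?U (?w t) (m + Suc i)) = (\<Prod>i<j. 1 + ?U w (m + Suc i))" for t
        by (intro prod.cong refl arg_cong2[where f = "(+)"] chain_upd) auto
      then have eq: "?Z (Suc j) (?w t) = (\<Prod>i<j. 1 + ?U w (m + Suc i))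
          * ((1 + step l k (?U w (m + j)) (ratio t)) * f (step l k (?U w (m + j)) (ratio t)))" for t
        using chain_Suc_upd[of l k a w "m + j" t]
        by (simp only: prod.lessThan_Suc add_Suc_right mult.assoc)
      show "expectation (\<lambda>t. ?Z (Suc j) (?w t)) \<le> c * ?Z j w"
        unfolding eq integral_mult_right_zero
        using mult_left_mono[OF drift[OF chain_bounds(2)[OF l k, of a w "m + j"]] P0[of w j]]
        by (simp only: mult_ac)
    next
      show "\<bar>?Z (Suc j) w\<bar> \<le> (1 + 2 * k) ^ Suc j * D" for w by (rule bd)
      show "integrable env_law (\<lambda>w. c * ?Z j w)" using int[of j] by simp
    qed measurable
    also have "\<dots> = c * E.expectation (?Z j)" by simp
    also have "\<dots> \<le> c ^ Suc j * D" using Suc c mult_left_mono[OF Suc c] by (simp add: mult_ac)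
    finally show ?case .
  qed
qed

text \<open>\<open>H\<close> is positive only if the chain is alive at time \<open>2 * n\<close>;
  then the product is at most \<open>M\<close> or exceeds it. Markov's inequality bounds the second
  case, since \<open>f \<ge> 1\<close> on living states.\<close>

lemma prob_good_ge:
  assumes l: "0 < l" and k: "0 < k" "k \<le> 1/2" and c: "0 \<le> c" and M: "0 < M" and n: "0 < n" "b \<le> n"
    and f_meas: "f \<in> borel_measurable borel" and f1: "\<And>u. 0 \<le> u \<Longrightarrow> 1 \<le> f u"
    and f: "\<And>u. u \<le> 2 * k \<Longrightarrow> 0 \<le> f u \<and> f u \<le> D"
    and drift: "\<And>u. u \<le> 2 * k \<Longrightarrow>
      expectation (\<lambda>t. (1 + step l k u (ratio t)) * f (step l k u (ratio t))) \<le> c * f u"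
    and H: "survival_fun C l k H" and A [measurable]: "A \<in> sets env_law"
  shows "E.expectation (\<lambda>w. indicator A w * H (chain l k a w (2 * n))) - c ^ b * D / M
    \<le> E.prob (A \<inter> {w. 0 \<le> chain l k a w (2 * n) \<and> (\<Prod>i<b. 1 + chain l k a w (n + i)) \<le> M})"
proof -
  let ?U = "chain l k a"
  let ?P = "\<lambda>w. \<Prod>i<b. 1 + ?U w (n + i)"
  let ?Z = "\<lambda>w. ?P w * f (?U w (n - 1 + b))"
  define G where "G = {w. 0 \<le> ?U w (2 * n) \<and> ?P w \<le> M}"
  define B where "B = {w. 0 \<le> ?U w (2 * n) \<and> M < ?P w}"
  have [measurable]: "G \<in> sets env_law"
  proof -
    have "{w \<in> space env_law. 0 \<le> ?U w (2 * n) \<and> ?P w \<le> M} \<in> sets env_law" by measurable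
    then show ?thesis by (simp add: G_def)
  qed
  have [measurable]: "B \<in> sets env_law"
  proof -
    have "{w \<in> space env_law. 0 \<le> ?U w (2 * n) \<and> M < ?P w} \<in> sets env_law" by measurable
    then show ?thesis by (simp add: B_def)
  qed
  have [measurable]: "H \<in> borel_measurable borel" and Hneg: "\<And>u. u < 0 \<Longrightarrow> H u = 0"
    and H01: "\<And>u. 0 \<le> H u" "\<And>u. H u \<le> 1"
    using H by (auto simp: survival_fun_def)
  have "E.expectation (\<lambda>w. indicator A w * H (?U w (2 * n)))
      \<le> E.expectation (\<lambda>w. indicator (A \<inter> G) w + indicator B w)"
  proof (rule integral_mono)
    show "integrable env_law (\<lambda>w. indicator A w * H (?U w (2 * n)))"
      using H01 by (intro E.integrable_const_bound[where B = 1]) (auto simp: indicator_def)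
    show "indicator A w * H (?U w (2 * n)) \<le> indicator (A \<inter> G) w + indicator B w" for w
      using H01[of "?U w (2 * n)"] Hneg[of "?U w (2 * n)"]
      by (auto simp: indicator_def G_def B_def not_le)
    show "integrable env_law (\<lambda>w. indicator (A \<inter> G) w + indicator B w :: real)"
      by (rule E.integrable_const_bound[where B = 2]) (auto simp: indicator_def)
  qed
  also have "\<dots> = E.prob (A \<inter> G) + E.prob B"
    by (subst Bochner_Integration.integral_add)
      (auto intro!: E.integrable_const_bound[where B = 1] simp: indicator_def)
  finally have 1: "E.expectation (\<lambda>w. indicator A w * H (?U w (2 * n))) \<le> E.prob (A \<inter> G) + E.prob B" .
  have idx: "n - 1 + Suc i = n + i" for i using n by simp
  \<comment> \<open>The factors are counted from state \<open>n\<close>, hence the shift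
    \<open>m = n - 1\<close>. The last state \<open>n - 1 + b\<close> comes no later than
    \<open>2 * n\<close>, so survival gives \<open>f \<ge> 1\<close> there.\<close>
  note passage = passage_chain[OF l k c f_meas f drift, where j = b and m = "n - 1" and a = a, unfolded idx]
  have "M * E.prob B = E.expectation (\<lambda>w. M * indicator B w)" by simp
  also have "\<dots> \<le> E.expectation ?Z"
  proof (intro integral_mono passage(1))
    fix w
    have "0 \<le> 1 + ?U w j" for j using chain_bounds(1)[OF l k, of a w j] by simp
    then have fP: "0 \<le> ?P w" by (intro prod_nonneg) blast
    have f0: "0 \<le> f (?U w (n - 1 + b))" using f chain_bounds(2)[OF l k] by blast
    show "M * indicator B w \<le> ?Z w"
    proof (cases "w \<in> B")
      case True
      then have "0 \<le> ?U w (n - 1 + b)"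
        using n chain_alive_mono[of l k a w "2 * n" "n - 1 + b"] by (simp add: B_def)
      then have "M * 1 \<le> ?P w * f (?U w (n - 1 + b))"
        using True M f1 by (intro mult_mono) (auto simp: B_def)
      then show ?thesis using True by simp
    next
      case False
      then show ?thesis using fP f0 by simp
    qed
  next
    show "integrable env_law (\<lambda>w. M * indicator B w)"
      by (intro integrable_mult_right E.integrable_const_bound[where B = 1]) (auto simp: indicator_def)
  qed
  also have "\<dots> \<le> c ^ b * D" by (rule passage(2))
  finally have "E.prob B \<le> c ^ b * D / M" using M by (simp add: field_simps)
  with 1 show ?thesis unfolding G_def by simp
qed

end

lemma exp_le_one_minus_power:
  fixes x :: real
  assumes "0 \<le> x" "x \<le> 1/2"
  shows "exp (- (2 * real n * x)) \<le> (1 - x) ^ n"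
proof -
  have "exp (- (2 * x)) \<le> 1 - x"
  proof -
    have "exp (- (2 * x)) = 1 / exp (2 * x)" by (simp add: exp_minus inverse_eq_divide)
    also have "\<dots> \<le> 1 / (1 + 2 * x)"
      using assms by (intro divide_left_mono exp_ge_add_one_self) auto
    also have "\<dots> \<le> 1 - x"
      using assms mult_left_mono[of x "1/2" x] by (simp add: field_simps)
    finally show ?thesis .
  qed
  then have "exp (- (2 * x)) ^ n \<le> (1 - x) ^ n" by (intro power_mono) auto
  also have "exp (- (2 * x)) ^ n = exp (- (2 * real n * x))"
    by (simp flip: exp_of_nat_mult)
  finally show ?thesis .
qed

lemma exp_minus_le_inverse: "0 < x \<Longrightarrow> exp (- x) \<le> 1 / (x :: real)"
  using exp_gt_self[of x] by (simp add: exp_minus inverse_eq_divide frac_le)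

section \<open>Slowdown bounds along random times\<close>

context iid_env
begin

text \<open>\<open>(1 + \<mu>) / (1 - \<mu>)\<close> is the inverse speed, so
  \<open>\<theta>\<close> measures the gap below the speed. Half of it is spent on fluctuations of
  the passage product, the other half is the rate.\<close>

lemma frequently_quenched_law_le:
  assumes v: "0 < v" "v * ((1 + \<mu>) / (1 - \<mu>)) < 1" and L: "0 < L"
  defines "\<theta> \<equiv> 1 - v * ((1 + \<mu>) / (1 - \<mu>))"
  shows "AE w in env_law. \<exists>\<^sub>F n in sequentially.
    measure (quenched_law w) {X. real_of_int (X n) / real n < v}
      \<le> exp (- (\<theta> / 2 * (L * real n powr (1 - 1 / s))))"
proof -
  define m where "m = (1 + \<mu>) / (1 - \<mu>)"
  have m1: "1 \<le> m" using mu_bounds by (simp add: m_def)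
  have th: "\<theta> = 1 - v * m" "0 < \<theta>" using v by (auto simp: \<theta>_def m_def)
  have v1: "v < 1"
  proof -
    have "v * 1 \<le> v * m" using v m1 by (intro mult_left_mono) auto
    then show ?thesis using th by simp
  qed
  define p where "p = min 2 ((1 + s) / 2)"
  have p: "1 < p" "p < s" "p \<le> 2" using s_gt_1 by (auto simp: p_def min_less_iff_disj)
  obtain k1 where k1: "0 < k1" and surv: "\<And>k. 0 < k \<Longrightarrow> k \<le> k1 \<Longrightarrow>
      \<exists>C\<ge>0. \<exists>l0>0. \<forall>l. 0 < l \<longrightarrow> l \<le> l0 \<longrightarrow> (\<exists>H. survival_fun C l k H)"
    using survival_drift by blast
  obtain k2 where k2: "0 < k2" and pass: "\<And>k. 0 < k \<Longrightarrow> k \<le> k2 \<Longrightarrow>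
    \<exists>C\<ge>0. \<exists>D. \<forall>l. 0 < l \<longrightarrow>
    (\<exists>f. f \<in> borel_measurable borel \<and> (\<forall>u\<ge>0. 1 \<le> f u) \<and> (\<forall>u\<le>2 * k. 0 \<le> f u \<and> f u \<le> D) \<and>
     (\<forall>u\<le>2 * k. expectation (\<lambda>t. (1 + step l k u (ratio t)) * f (step l k u (ratio t)))
        \<le> (1 + l * m + C * l powr p) * f u))"
    using passage_drift[OF p] unfolding m_def by blast
  obtain k3 g where k3: "0 < k3" and g: "0 \<le> g" "g < 1" and mean: "\<And>k l u. 0 < k \<Longrightarrow> k \<le> k3 \<Longrightarrow> 0 < l \<Longrightarrow>
     expectation (\<lambda>t. max 0 (step l k u (ratio t))) \<le> g * max 0 u + 4 * l"
    using mean_drift by blast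
  define k where "k = min (min k1 k2) (min k3 (1/2))"
  have k: "0 < k" "k \<le> 1/2" "k \<le> k1" "k \<le> k2" "k \<le> k3" "k < 1"
    using k1 k2 k3 by (auto simp: k_def min_le_iff_disj min_less_iff_disj)
  obtain C l0 where C: "0 \<le> C" and l0: "0 < l0"
    and H: "\<And>l. 0 < l \<Longrightarrow> l \<le> l0 \<Longrightarrow> \<exists>H. survival_fun C l k H"
    using surv[OF k(1,3)] by blast
  obtain C' D where C': "0 \<le> C'" and f: "\<And>l. 0 < l \<Longrightarrow>
    \<exists>f. f \<in> borel_measurable borel \<and> (\<forall>u\<ge>0. 1 \<le> f u) \<and> (\<forall>u\<le>2 * k. 0 \<le> f u \<and> f u \<le> D) \<and>
     (\<forall>u\<le>2 * k. expectation (\<lambda>t. (1 + step l k u (ratio t)) * f (step l k u (ratio t)))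
        \<le> (1 + l * m + C' * l powr p) * f u)"
    using pass[OF k(1,4)] by blast
  have D: "0 \<le> D"
    using f[of 1] k by (auto dest!: spec[of _ 0] intro: order_trans)
  \<comment> \<open>For \<open>n > 0\<close> this makes \<open>n * l n powr s\<close> the constant
    \<open>L powr s\<close>, which keeps survival likely enough, and \<open>l n * n\<close> equal to
    \<open>L * n powr (1 - 1 / s)\<close>, the required rate.\<close>
  define l where "l n = L * real n powr (- (1 / s))" for n
  define b where "b n = nat \<lceil>real n * v\<rceil>" for n
  \<comment> \<open>The mean product grows at rate \<open>v * m\<close>, and
    \<open>v * m + \<theta> = 1\<close> is the decay rate; the threshold lies halfway
    between.\<close>
  define M where "M n = exp (l n * real n * (v * m + \<theta> / 2))" for n
  define G where "G n = {w. 0 \<le> chain (l n) k (- int n) w (2 * n) \<and>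
      (\<Prod>i<b n. 1 + chain (l n) k (- int n) w (n + i)) \<le> M n}" for n
  have l_pos: "0 < l n" if "0 < n" for n using that L by (simp add: l_def)
  have ln: "l n * real n = L * real n powr (1 - 1 / s)" if "0 < n" for n
    using that by (simp add: l_def powr_diff powr_minus field_simps)
  have l_powr_s: "l n powr s = L powr s / real n" if "0 < n" for n
  proof -
    have "l n powr s = L powr s * real n powr - 1"
      using L s_gt_1 by (simp add: l_def powr_mult powr_powr)
    then show ?thesis using that by (simp add: powr_minus_divide)
  qed
  have b_le: "b n \<le> n" for n
  proof -
    have "real n * v \<le> real n * 1" using v1 by (intro mult_left_mono) auto
    then have "\<lceil>real n * v\<rceil> \<le> int n" by (intro ceiling_le) simp
    then show ?thesis unfolding b_def by linarith
  qed
  have b_ge: "real n * v \<le> real_of_int (int (b n))" for n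
    using v by (simp add: b_def)
  have b_less: "real (b n) \<le> real n * v + 1" for n
    using v by (simp add: b_def)
  have l_lim: "l \<longlonglongrightarrow> 0"
  proof -
    have "(\<lambda>n. L * real n powr (- (1 / s))) \<longlonglongrightarrow> L * 0"
      using s_gt_1 by (intro tendsto_mult tendsto_const tendsto_neg_powr filterlim_real_sequentially) auto
    then show ?thesis by (simp add: l_def[abs_def])
  qed
  have [measurable]: "G n \<in> sets env_law" for n
  proof -
    have "{w \<in> space env_law. 0 \<le> chain (l n) k (- int n) w (2 * n) \<and>
      (\<Prod>i<b n. 1 + chain (l n) k (- int n) w (n + i)) \<le> M n} \<in> sets env_law" by measurable
    then show ?thesis by (simp add: G_def)
  qed
  have good: "measure (quenched_law w) {X. real_of_int (X n) / real n < v}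
      \<le> exp (- (\<theta> / 2 * (L * real n powr (1 - 1 / s))))"
    if w: "\<forall>x. 0 < w x \<and> w x \<le> 1" and "w \<in> G n" and n: "0 < n" "l n \<le> 1" for w n
  proof -
    interpret Q: prob_space "quenched_law w" by (rule prob_space_quenched_law)
    have "real_of_int (X n) / real n < v \<Longrightarrow> X n < int (b n)" for X
      using b_ge[of n] n by (simp add: field_simps)
    moreover have "{X. X n < int (b n)} \<in> sets (quenched_law w)"
      using sets_quenched_law_cylinder[of 0 "\<lambda>_. 0" "\<lambda>x. x < int (b n)" n w] by simp
    ultimately have "measure (quenched_law w) {X. real_of_int (X n) / real n < v}
        \<le> measure (quenched_law w) {X. X n < int (b n)}"
      by (intro Q.finite_measure_mono) auto
    also have "\<dots> \<le> (1 - l n) ^ n * M n"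
      using that w l_pos k b_le by (intro quenched_law_chain_le) (auto simp: G_def)
    also have "\<dots> \<le> exp (- l n) ^ n * M n"
      using n exp_ge_add_one_self[of "- l n"] by (intro mult_right_mono power_mono) (auto simp: M_def)
    also have "\<dots> = exp (- (\<theta> / 2 * (l n * real n)))"
      unfolding M_def th(1) by (simp add: algebra_simps flip: exp_of_nat_mult exp_add)
    finally show ?thesis using ln[OF n(1)] by simp
  qed
  \<comment> \<open>The last inequality bounds, relative to \<open>l n * n\<close>, the errors from
    rounding \<open>n * v\<close> up and from the term \<open>C' * l n powr p\<close>.\<close>
  have ev_l: "\<forall>\<^sub>F n in sequentially. 0 < n \<and> l n \<le> l0 \<and> l n \<le> 1 \<and> C * l n powr s \<le> 1/2 \<and>
      m / real n + C' * l n powr (p - 1) * (v + 1 / real n) \<le> \<theta> / 4"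
  proof -
    have "(\<lambda>n. C * (L powr s / real n)) \<longlonglongrightarrow> C * 0"
      by (intro tendsto_intros lim_const_over_n)
    then have "\<forall>\<^sub>F n in sequentially. C * (L powr s / real n) < 1/2"
      by (rule order_tendstoD) simp
    moreover have "(\<lambda>n. l n powr (p - 1)) \<longlonglongrightarrow> 0"
    proof -
      have "(\<lambda>n. L powr (p - 1) * real n powr (- ((p - 1) / s))) \<longlonglongrightarrow> L powr (p - 1) * 0"
        using s_gt_1 p by (intro tendsto_mult tendsto_const tendsto_neg_powr filterlim_real_sequentially) auto
      moreover have "l n powr (p - 1) = L powr (p - 1) * real n powr (- ((p - 1) / s))" for n
        using L by (simp add: l_def powr_mult powr_powr algebra_simps)
      ultimately show ?thesis by simp
    qed
    then have "(\<lambda>n. m / real n + C' * l n powr (p - 1) * (v + 1 / real n))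
        \<longlonglongrightarrow> 0 + C' * 0 * (v + 0)"
      by (intro tendsto_intros lim_const_over_n)
    then have "\<forall>\<^sub>F n in sequentially. m / real n + C' * l n powr (p - 1) * (v + 1 / real n) < \<theta> / 4"
      by (rule order_tendstoD) (use th in simp)
    moreover have "\<forall>\<^sub>F n in sequentially. l n < l0" "\<forall>\<^sub>F n in sequentially. l n < 1"
      using l0 by (auto intro: order_tendstoD[OF l_lim])
    ultimately show ?thesis using eventually_gt_at_top[of 0]
      by eventually_elim (auto simp: l_powr_s)
  qed
  have "AE w in env_law. \<exists>\<^sub>F n in sequentially. w \<in> G n"
  \<comment> \<open>As \<open>n * l n powr s = L powr s\<close> and
    \<open>exp (- 2 * x) \<le> 1 - x\<close> on \<open>[0, 1/2]\<close>, this \<open>d\<close>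
    bounds \<open>(1 - C * l n powr s) ^ (2 * n)\<close> from below for all large
    \<open>n\<close>.\<close>
  proof (rule AE_frequently_cylinders[where d = "exp (- (4 * (C * L powr s)))"])
    fix K A assume A: "A \<in> cylinders K"
    then have A_sets: "A \<in> sets env_law" by (simp add: cylinders_def)
    \<comment> \<open>The first term is the loss at the sites of the window; the second bounds the
      probability of surviving with a product above \<open>M n\<close>.\<close>
    define e where "e n = (2 * real K + 1) * (C * (l n + 4 * l n / (1 - g)))
        + D * (4 / (\<theta> * L)) * real n powr (- (1 - 1 / s))" for n
    have "e \<longlonglongrightarrow> (2 * real K + 1) * (C * (0 + 4 * 0 / (1 - g))) + D * (4 / (\<theta> * L)) * 0"
      unfolding e_def using g s_gt_1
      by (intro tendsto_intros l_lim tendsto_neg_powr filterlim_real_sequentially) auto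
    then have "e \<longlonglongrightarrow> 0" by simp
    moreover have "\<forall>\<^sub>F n in sequentially. exp (- (4 * (C * L powr s))) * E.prob A - e n \<le> E.prob (A \<inter> G n)"
      using ev_l
    proof eventually_elim
      case (elim n)
      then have n: "0 < n" and ll: "l n \<le> l0" "C * l n powr s \<le> 1/2"
        and sm: "m / real n + C' * l n powr (p - 1) * (v + 1 / real n) \<le> \<theta> / 4" by auto
      note l = l_pos[OF n]
      obtain h where h: "survival_fun C (l n) k h" using H[OF l ll(1)] by blast
      obtain f' where f': "f' \<in> borel_measurable borel" "\<And>u. 0 \<le> u \<Longrightarrow> 1 \<le> f' u"
        "\<And>u. u \<le> 2 * k \<Longrightarrow> 0 \<le> f' u \<and> f' u \<le> D"
        "\<And>u. u \<le> 2 * k \<Longrightarrow> expectation (\<lambda>t. (1 + step (l n) k u (ratio t)) * f' (step (l n) k u (ratio t)))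
          \<le> (1 + l n * m + C' * l n powr p) * f' u"
        using f[OF l] by blast
      define c where "c = 1 + l n * m + C' * l n powr p"
      have c: "1 \<le> c" using l m1 C' by (simp add: c_def)
      have "(1 - C * l n powr s) ^ (2 * n) * E.prob A - (2 * real K + 1) * (C * (l n + 4 * l n / (1 - g)))
          - c ^ b n * D / M n
        \<le> E.expectation (\<lambda>w. indicator A w * h (chain (l n) k (- int n) w (2 * n))) - c ^ b n * D / M n"
        using ll C l
        by (intro diff_right_mono survival_chain[OF l k(1,2) g mean[OF k(1,5) l] h C _ A]) auto
      also have "\<dots> \<le> E.prob (A \<inter> G n)"
        unfolding G_def using c f' n b_le
        by (intro prob_good_ge[OF l k(1,2) _ _ n _ f'(1,2,3) _ h A_sets]) (auto simp: M_def c_def)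
      finally have 1: "(1 - C * l n powr s) ^ (2 * n) * E.prob A
          - (2 * real K + 1) * (C * (l n + 4 * l n / (1 - g))) - c ^ b n * D / M n \<le> E.prob (A \<inter> G n)" .
      have "exp (- (2 * real (2 * n) * (C * l n powr s))) \<le> (1 - C * l n powr s) ^ (2 * n)"
        using C ll by (intro exp_le_one_minus_power) auto
      also have "2 * real (2 * n) * (C * l n powr s) = 4 * (C * L powr s)"
        using n by (simp add: l_powr_s)
      finally have 2: "exp (- (4 * (C * L powr s))) * E.prob A \<le> (1 - C * l n powr s) ^ (2 * n) * E.prob A"
        by (intro mult_right_mono) auto
      have lp: "l n powr p = l n * l n powr (p - 1)"
        using l by (simp add: powr_diff)
      have "c ^ b n \<le> exp (l n * m + C' * l n powr p) ^ b n"
        using c exp_ge_add_one_self[of "l n * m + C' * l n powr p"]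
        by (intro power_mono) (simp_all add: c_def add.assoc)
      also have "\<dots> = exp (real (b n) * (l n * m + C' * l n powr p))"
        by (simp add: exp_of_nat_mult)
      also have "\<dots> \<le> exp ((real n * v + 1) * (l n * m + C' * l n powr p))"
        using b_less[of n] l m1 C' by (intro exp_le_cancel_iff[THEN iffD2] mult_right_mono) auto
      also have "(real n * v + 1) * (l n * m + C' * l n powr p)
          = l n * real n * (v * m + (m / real n + C' * l n powr (p - 1) * (v + 1 / real n)))"
        unfolding lp using n by (simp add: field_simps)
      also have "exp \<dots> \<le> exp (l n * real n * (v * m + \<theta> / 4))"
        using sm l by (intro exp_le_cancel_iff[THEN iffD2] mult_left_mono add_left_mono) auto
      finally have "c ^ b n / M n \<le> exp (l n * real n * (v * m + \<theta> / 4)) / M n"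
        by (intro divide_right_mono) (auto simp: M_def)
      also have "\<dots> = exp (- (l n * real n * (\<theta> / 4)))"
        unfolding M_def by (simp add: algebra_simps flip: exp_diff)
      also have "\<dots> \<le> 1 / (l n * real n * (\<theta> / 4))"
        using l n th by (intro exp_minus_le_inverse) auto
      also have "\<dots> = 4 / (\<theta> * L) * real n powr (- (1 - 1 / s))"
        unfolding ln[OF n] powr_minus by (simp add: field_simps)
      finally have "D * (c ^ b n / M n) \<le> D * (4 / (\<theta> * L) * real n powr (- (1 - 1 / s)))"
        using D by (rule mult_left_mono)
      moreover have "c ^ b n * D / M n = D * (c ^ b n / M n)" by simp
      ultimately have "c ^ b n * D / M n \<le> D * (4 / (\<theta> * L)) * real n powr (- (1 - 1 / s))"
        unfolding mult.assoc by (simp only:)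
      with 1 2 show ?case unfolding e_def by linarith
    qed
    ultimately show "\<exists>e. e \<longlonglongrightarrow> 0 \<and>
      (\<forall>\<^sub>F n in sequentially. exp (- (4 * (C * L powr s))) * E.prob A - e n \<le> E.prob (A \<inter> G n))" by blast
  qed auto
  with AE_env_law show ?thesis
  proof eventually_elim
    case (elim w)
    have "\<forall>\<^sub>F n in sequentially. 0 < n \<and> l n \<le> 1" using ev_l by eventually_elim auto
    then show ?case
      using elim good by (auto elim!: frequently_rev_mp eventually_mono)
  qed
qed

end

section \<open>Transfer to the law of the environment\<close>

lemma liminf_eq_minus_infinityI:
  fixes f :: "nat \<Rightarrow> ereal"
  assumes "\<And>L::nat. 0 < L \<Longrightarrow> \<exists>\<^sub>F n in sequentially. f n \<le> ereal (- (c * real L))" "0 < c"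
  shows "liminf f = - \<infinity>"
proof -
  have le: "liminf f \<le> ereal (- (c * real L))" if "0 < L" for L :: nat
  proof (rule ccontr)
    assume "\<not> ?thesis"
    then have "\<forall>\<^sub>F n in sequentially. ereal (- (c * real L)) < f n"
      by (intro less_LiminfD) simp
    then have "\<forall>\<^sub>F n in sequentially. \<not> f n \<le> ereal (- (c * real L))"
      by eventually_elim (simp add: not_le)
    then show False using assms(1)[OF that] by (simp add: frequently_def)
  qed
  show ?thesis
  proof (rule ereal_bot)
    fix B :: real
    obtain L :: nat where "- B / c < real L" using reals_Archimedean2 by blast
    then have "- (c * real (Suc L)) \<le> B" using assms(2) by (simp add: field_simps)
    then show "liminf f \<le> ereal B" using le[of "Suc L"] by (meson ereal_less_eq(3) order_trans zero_less_Suc)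
  qed
qed

lemma scaled_log_ereal_le:
  assumes "0 \<le> p" "p \<le> exp (- (c * x))" "0 < x"
  shows "ereal (1 / x) * log_ereal (ereal p) \<le> ereal (- c)"
proof (cases "p = 0")
  case True
  then show ?thesis using assms by (simp add: log_ereal_def)
next
  case False
  then have "0 < p" using assms by simp
  then have "ln p \<le> - (c * x)" using assms(2) by (metis ln_exp ln_le_cancel_iff exp_gt_zero)
  then have "1 / x * ln p \<le> 1 / x * (- (c * x))" using assms by (intro mult_left_mono) auto
  then show ?thesis using \<open>0 < p\<close> assms by (simp add: log_ereal_def)
qed

lemma ext_expectation_nonneg:
  assumes "\<And>x. x \<in> space M \<Longrightarrow> 0 \<le> f x"
  shows "ext_expectation M f = enn2ereal (\<integral>\<^sup>+x. e2ennreal (f x) \<partial>M)"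
proof -
  have "(\<integral>\<^sup>+x. e2ennreal (- f x) \<partial>M) = (\<integral>\<^sup>+x. 0 \<partial>M)"
    using assms by (intro nn_integral_cong) (simp add: e2ennreal_neg)
  then show ?thesis by (simp add: ext_expectation_def zero_ennreal.rep_eq)
qed

section \<open>Reduction of the hypotheses to the law of one site\<close>

context
  fixes \<alpha> :: "env measure" and s :: real
  assumes iid: "iid_environment \<alpha>"
    and log_moment: "ext_expectation \<alpha> (\<lambda>\<omega>. log_ereal (rho \<omega> 0)) < 0"
    and s: "s > 1"
    and moment: "ext_expectation \<alpha> (\<lambda>\<omega>. powr_ereal (rho \<omega> 0) s) = 1"
begin

definition site_law :: "real measure" where
  "site_law = distr \<alpha> borel (\<lambda>\<omega>. \<omega> 0)"

lemma prob_space_alpha: "prob_space \<alpha>"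
  and sets_alpha: "sets \<alpha> = sets env_space"
  and indep: "prob_space.indep_vars \<alpha> (\<lambda>_. borel) (\<lambda>x \<omega>. \<omega> x) UNIV"
  and distr_alpha: "distr \<alpha> borel (\<lambda>\<omega>. \<omega> x) = site_law"
  using iid by (auto simp: iid_environment_def site_law_def)

lemma measurable_alpha: "(\<lambda>\<omega>. \<omega> x) \<in> borel_measurable \<alpha>"
  using indep by (auto simp: prob_space.indep_vars_def[OF prob_space_alpha])

lemma space_alpha: "\<omega> \<in> space \<alpha> \<Longrightarrow> 0 \<le> \<omega> x \<and> \<omega> x \<le> 1"
  using sets_eq_imp_space_eq[OF sets_alpha] by (auto simp: env_space_def space_PiM space_restrict_space)

lemma rho_nonneg: "\<omega> \<in> space \<alpha> \<Longrightarrow> 0 \<le> rho \<omega> x"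
  using space_alpha[of \<omega> x] by (cases "\<omega> x = 0") (auto simp: rho_def)

lemma rho_eq: "0 < \<omega> x \<Longrightarrow> \<omega> x \<le> 1 \<Longrightarrow> rho \<omega> x = ereal (ratio (\<omega> x))"
  by (simp add: rho_def ratio_def)

lemma measurable_rho: "(\<lambda>\<omega>. rho \<omega> 0) \<in> borel_measurable \<alpha>"
  using measurable_alpha[of 0] unfolding rho_def by measurable

lemma nn_moment: "(\<integral>\<^sup>+\<omega>. e2ennreal (powr_ereal (rho \<omega> 0) s) \<partial>\<alpha>) = 1"
proof -
  have "ext_expectation \<alpha> (\<lambda>\<omega>. powr_ereal (rho \<omega> 0) s)
      = enn2ereal (\<integral>\<^sup>+\<omega>. e2ennreal (powr_ereal (rho \<omega> 0) s) \<partial>\<alpha>)"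
    by (rule ext_expectation_nonneg) (simp add: powr_ereal_def)
  then have "enn2ereal (\<integral>\<^sup>+\<omega>. e2ennreal (powr_ereal (rho \<omega> 0) s) \<partial>\<alpha>) = enn2ereal 1"
    using moment by (simp add: one_ennreal.rep_eq)
  then show ?thesis by (simp add: enn2ereal_inject)
qed

text \<open>At \<open>\<omega> 0 = 0\<close> the ratio is infinite, which the finite moment of order
  \<open>s\<close> allows only with probability zero.\<close>

lemma AE_site_pos: "AE \<omega> in \<alpha>. 0 < \<omega> 0 \<and> \<omega> 0 \<le> 1"
proof -
  have m: "(\<lambda>\<omega>. e2ennreal (powr_ereal (rho \<omega> 0) s)) \<in> borel_measurable \<alpha>"
    using measurable_rho unfolding powr_ereal_def by measurable
  have "AE \<omega> in \<alpha>. e2ennreal (powr_ereal (rho \<omega> 0) s) \<noteq> \<infinity>"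
    using nn_integral_PInf_AE[OF m] nn_moment by simp
  with AE_space show ?thesis
  proof eventually_elim
    case (elim \<omega>)
    then have "\<omega> 0 \<noteq> 0" by (auto simp: rho_def powr_ereal_def)
    with space_alpha[of \<omega> 0] elim show ?case by simp
  qed
qed

lemma AE_site_law: "AE t in site_law. 0 < t \<and> t \<le> 1"
  unfolding site_law_def using AE_site_pos
  by (subst AE_distr_iff) (auto intro: measurable_alpha)

lemma moment_site_law:
  "integrable site_law (\<lambda>t. ratio t powr s)" "(\<integral>t. ratio t powr s \<partial>site_law) = 1"
proof -
  have "(\<integral>\<^sup>+t. ennreal (ratio t powr s) \<partial>site_law) = (\<integral>\<^sup>+\<omega>. ennreal (ratio (\<omega> 0) powr s) \<partial>\<alpha>)"
    unfolding site_law_def by (rule nn_integral_distr) (use measurable_alpha in auto)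
  also have "\<dots> = (\<integral>\<^sup>+\<omega>. e2ennreal (powr_ereal (rho \<omega> 0) s) \<partial>\<alpha>)"
    using AE_site_pos by (intro nn_integral_cong_AE) (auto simp: rho_eq powr_ereal_def ennreal.rep_eq)
  finally have nn: "(\<integral>\<^sup>+t. ennreal (ratio t powr s) \<partial>site_law) = ennreal 1" using nn_moment by simp
  have m: "(\<lambda>t. ratio t powr s) \<in> borel_measurable site_law"
    unfolding site_law_def by measurable
  show "integrable site_law (\<lambda>t. ratio t powr s)"
    using m nn by (intro integrableI_nn_integral_finite[where x = 1]) auto
  show "(\<integral>t. ratio t powr s \<partial>site_law) = 1"
    using m nn by (intro integral_eq_nn_integral[THEN trans]) auto
qed

text \<open>A ratio almost surely equal to 1 would make the logarithmic moment 0 instead of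
  negative.\<close>

lemma ratio_not_one: "\<not> (AE t in site_law. ratio t = 1)"
proof
  assume "AE t in site_law. ratio t = 1"
  then have "AE \<omega> in \<alpha>. ratio (\<omega> 0) = 1"
    unfolding site_law_def by (subst (asm) AE_distr_iff) (use measurable_alpha in auto)
  with AE_site_pos have ae: "AE \<omega> in \<alpha>. log_ereal (rho \<omega> 0) = 0"
  proof eventually_elim
    case (elim \<omega>)
    then show ?case by (simp add: rho_eq log_ereal_def)
  qed
  have "(\<integral>\<^sup>+\<omega>. e2ennreal (log_ereal (rho \<omega> 0)) \<partial>\<alpha>) = (\<integral>\<^sup>+\<omega>. 0 \<partial>\<alpha>)"
    "(\<integral>\<^sup>+\<omega>. e2ennreal (- log_ereal (rho \<omega> 0)) \<partial>\<alpha>) = (\<integral>\<^sup>+\<omega>. 0 \<partial>\<alpha>)"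
    by (rule nn_integral_cong_AE, use ae in \<open>eventually_elim; simp add: e2ennreal_neg\<close>)+
  then have "ext_expectation \<alpha> (\<lambda>\<omega>. log_ereal (rho \<omega> 0)) = 0"
    by (simp add: ext_expectation_def zero_ennreal.rep_eq)
  then show False using log_moment by simp
qed

lemma iid_env_site_law: "iid_env site_law s"
proof -
  interpret prob_space \<alpha> by (rule prob_space_alpha)
  have "prob_space site_law" unfolding site_law_def by (rule prob_space_distr[OF measurable_alpha])
  then interpret S: prob_space site_law .
  show ?thesis
    by unfold_locales
      (use moment_site_law ratio_not_one s ratio_nonneg AE_site_law in \<open>auto simp: site_law_def\<close>)
qed

lemma ext_expectation_rho: "ext_expectation \<alpha> (\<lambda>\<omega>. rho \<omega> 0) = ereal (\<integral>t. ratio t \<partial>site_law)"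
proof -
  interpret S: iid_env site_law s by (rule iid_env_site_law)
  have "ext_expectation \<alpha> (\<lambda>\<omega>. rho \<omega> 0) = enn2ereal (\<integral>\<^sup>+\<omega>. e2ennreal (rho \<omega> 0) \<partial>\<alpha>)"
    by (rule ext_expectation_nonneg) (rule rho_nonneg)
  also have "(\<integral>\<^sup>+\<omega>. e2ennreal (rho \<omega> 0) \<partial>\<alpha>) = (\<integral>\<^sup>+\<omega>. ennreal (ratio (\<omega> 0)) \<partial>\<alpha>)"
    using AE_site_pos by (intro nn_integral_cong_AE) (auto simp: rho_eq)
  also have "\<dots> = (\<integral>\<^sup>+t. ennreal (ratio t) \<partial>site_law)"
    unfolding site_law_def by (rule nn_integral_distr[symmetric]) (use measurable_alpha in auto)
  also have "\<dots> = ennreal (\<integral>t. ratio t \<partial>site_law)"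
    using S.integrable_r ratio_nonneg by (intro nn_integral_eq_integral) auto
  also have "enn2ereal \<dots> = ereal (\<integral>t. ratio t \<partial>site_law)"
    using ratio_nonneg by (intro enn2ereal_ennreal integral_nonneg) auto
  finally show ?thesis .
qed

text \<open>\<alpha> lives on sequences in the unit interval, \<open>env_law\<close> on real
  sequences; independence makes the identity map carry one to the other.\<close>

lemma distr_alpha_env_law: "distr \<alpha> (\<Pi>\<^sub>M x\<in>UNIV. borel) (\<lambda>\<omega>. \<omega>) = iid_env.env_law site_law"
proof -
  interpret S: iid_env site_law s by (rule iid_env_site_law)
  have "distr \<alpha> (\<Pi>\<^sub>M x\<in>UNIV. borel) (\<lambda>\<omega>. \<lambda>x\<in>UNIV. \<omega> x) = (\<Pi>\<^sub>M x\<in>UNIV. distr \<alpha> borel (\<lambda>\<omega>. \<omega> x))"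
    using indep measurable_alpha
    by (subst prob_space.indep_vars_iff_distr_eq_PiM[OF prob_space_alpha, symmetric]) auto
  moreover have "(\<lambda>\<omega> :: env. \<lambda>x\<in>UNIV. \<omega> x) = (\<lambda>\<omega>. \<omega>)" by (simp add: restrict_def)
  ultimately show ?thesis by (simp add: distr_alpha S.env_law_def)
qed

lemma AE_alphaI:
  assumes "AE \<omega> in iid_env.env_law site_law. P \<omega>"
  shows "AE \<omega> in \<alpha>. P \<omega>"
proof (rule AE_distrD[where f = "\<lambda>\<omega>. \<omega>" and P = P])
  show "(\<lambda>\<omega>. \<omega>) \<in> \<alpha> \<rightarrow>\<^sub>M (\<Pi>\<^sub>M x\<in>UNIV. borel)"
    by (rule measurable_PiM_single') (auto intro: measurable_alpha)
  show "AE \<omega> in distr \<alpha> (\<Pi>\<^sub>M x\<in>UNIV. borel) (\<lambda>\<omega>. \<omega>). P \<omega>"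
    by (subst distr_alpha_env_law) (rule assms)
qed

text \<open>The constant is half of the gap \<open>1 - v * ((1 + \<mu>) / (1 - \<mu>))\<close> and
  does not depend on \<open>L\<close>, so \<open>L\<close> can be sent to infinity
  afterwards.\<close>

lemma AE_frequently_quenched_law_le:
  assumes v: "0 < v" "ereal v < speed \<alpha>"
  obtains c where "0 < c" "\<And>L. 0 < L \<Longrightarrow> AE \<omega> in \<alpha>. \<exists>\<^sub>F n in sequentially.
    measure (quenched_law \<omega>) {X. real_of_int (X n) / real n < v}
      \<le> exp (- (c * (L * real n powr (1 - 1 / s))))"
proof -
  interpret S: iid_env site_law s by (rule iid_env_site_law)
  let ?m = "(1 + S.\<mu>) / (1 - S.\<mu>)"
  have "speed \<alpha> = ereal ((1 - S.\<mu>) / (1 + S.\<mu>))"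
    using S.mu_bounds by (simp add: speed_def ext_expectation_rho S.\<mu>_def one_ereal_def)
  then have "v < (1 - S.\<mu>) / (1 + S.\<mu>)" using v by simp
  then have vm: "v * ?m < 1" using S.mu_bounds by (simp add: field_simps)
  show thesis
  proof (rule that)
    show "0 < (1 - v * ?m) / 2" using vm by simp
    show "AE \<omega> in \<alpha>. \<exists>\<^sub>F n in sequentially.
      measure (quenched_law \<omega>) {X. real_of_int (X n) / real n < v}
        \<le> exp (- ((1 - v * ?m) / 2 * (L * real n powr (1 - 1 / s))))" if "0 < L" for L
      by (rule AE_alphaI[OF S.frequently_quenched_law_le[OF v(1) vm that]])
  qed
qed

end

theorem theorem1p1:
  fixes \<alpha> :: "env measure" and s v :: real
  assumes "iid_environment \<alpha>"
    and "ext_expectation \<alpha> (\<lambda>\<omega>. log_ereal (rho \<omega> 0)) < 0"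
    and "s > 1"
    and "ext_expectation \<alpha> (\<lambda>\<omega>. powr_ereal (rho \<omega> 0) s) = 1"
    and "non_lattice \<alpha> (\<lambda>\<omega>. log_ereal (rho \<omega> 0))"
    and "ext_expectation \<alpha> (\<lambda>\<omega>. powr_ereal (rho \<omega> 0) s * log_ereal (rho \<omega> 0)) < \<infinity>"
    and "0 < v" and "ereal v < speed \<alpha>"
  shows "AE \<omega> in \<alpha>.
    liminf (\<lambda>n. ereal (1 / real n powr (1 - 1 / s)) *
      log_ereal (ereal (measure (quenched_law \<omega>) {X. real_of_int (X n) / real n < v}))) = - \<infinity>"
proof -
  obtain c where c: "0 < c" and ae: "\<And>L. 0 < L \<Longrightarrow> AE \<omega> in \<alpha>. \<exists>\<^sub>F n in sequentially.
    measure (quenched_law \<omega>) {X. real_of_int (X n) / real n < v}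
      \<le> exp (- (c * (L * real n powr (1 - 1 / s))))"
    using AE_frequently_quenched_law_le[OF assms(1-4,7,8)] by blast
  \<comment> \<open>One null set must serve every \<open>L\<close>; restricting to natural
    \<open>L\<close> leaves countably many.\<close>
  have "AE \<omega> in \<alpha>. \<forall>L::nat. 0 < L \<longrightarrow> (\<exists>\<^sub>F n in sequentially.
    measure (quenched_law \<omega>) {X. real_of_int (X n) / real n < v}
      \<le> exp (- (c * (real L * real n powr (1 - 1 / s)))))"
    unfolding AE_all_countable using ae by simp
  then show ?thesis
  proof eventually_elim
    case (elim \<omega>)
    show ?case
    proof (rule liminf_eq_minus_infinityI[OF _ c])
      fix L :: nat
      assume "0 < L"
      with elim have "\<exists>\<^sub>F n in sequentially.
          measure (quenched_law \<omega>) {X. real_of_int (X n) / real n < v}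
            \<le> exp (- (c * (real L * real n powr (1 - 1 / s))))"
        by blast
      from frequently_eventually_frequently[OF this eventually_gt_at_top[of 0]] show "\<exists>\<^sub>F n in sequentially. ereal (1 / real n powr (1 - 1 / s)) *
          log_ereal (ereal (measure (quenched_law \<omega>) {X. real_of_int (X n) / real n < v}))
            \<le> ereal (- (c * real L))"
        by (rule frequently_elim1) (auto intro!: scaled_log_ereal_le simp: mult.assoc)
    qed
  qed
qed

end
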